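(* Let $\chi^{1k\ell}$ and $\chi^{2k\ell m}$ be the first and second cell functions and let $C^0$, $C^1$, $C^2$ be the elastostatic effective tensors of order 4, 5, 6 (all defined in the context). Then, for all indices $i,j,k,\ell,m,n\in\{1,\dots,d\}$: (i) the leading-order effective tensor is given in terms of $\chi^1$ by $$C^0_{ijk\ell}=\frac{1}{|\mathcal Y|}A\big(\chi^{1ij}+P^{ij},\ \chi^{1k\ell}+P^{k\ell}\big),\qquad P^{ij}(x):=\tfrac12(x_i e_j+x_j e_i);$$ (ii) the first-order effective tensor is given in terms of $\chi^1$ by $$C^1_{ijk\ell m}=\frac{1}{|\mathcal Y|}\int_{\mathcal Y}\Big(S^{0,ij}_{mp}\,\chi^{1k\ell}_p-S^{0,k\ell}_{mp}\,\chi^{1ij}_p\Big)\,dy;$$ (iii) the second-order effective tensor is given in terms of $\chi^1$ and $\chi^2$ by $$C^2_{ijnk\ell m}=\frac{1}{|\mathcal Y|}\int_{\mathcal Y}\chi^{2ijn}_{p,q}\,C_{pqab}\,\chi^{2k\ell m}_{a,b}\,dy-\frac{1}{|\mathcal Y|}\int_{\mathcal Y}\chi^{1ij}_p\,C_{pnam}\,\chi^{1k\ell}_a\,dy .$$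
   Context: Let $d\in\{2,3\}$ and $(e_i)$ the canonical basis of $\mathbb R^d$; repeated indices are summed and $f_{,s}=\partial f/\partial y_s$. Cell and material. $v_1,\dots,v_d$ is a basis of $\mathbb R^d$ and $\mathcal Z=\{\sum_i n_iv_i:\ n_i\in\mathbb Z\}$. The periodicity cell $\mathcal Y\subset\mathbb R^d$ is a bounded open set (with Lebesgue-null boundary) whose translates $\mathcal Y+V$, $V\in\mathcal Z$, are pairwise disjoint and have closures covering $\mathbb R^d$. The elasticity tensor $C=(C_{ijk\ell})\in L^\infty(\mathcal Y)$ is real, has the symmetries $C_{ijk\ell}=C_{jik\ell}=C_{ij\ell k}=C_{k\ell ij}$ and satisfies $\varepsilon_{ij}C_{ijk\ell}(y)\varepsilon_{k\ell}\ge\kappa_m|\varepsilon|^2$ for all symmetric $\varepsilon$ and some $\kappa_m>0$. Function spaces. $H^1_{per}(\mathcal Y;\mathbb R^d)$ is the closure in $H^1(\mathcal Y)$ of smooth $\mathcal Z$-periodic vector functions on $\mathbb R^d$; $H^1_\#(\mathcal Y)$ is its subspace of zero-mean functions. $\langle f\rangle:=|\mathcal Y|^{-1}\int_{\mathcal Y}f\,dy$. The symmetric bilinear form $A$ is defined, for $w,v\in H^1(\mathcal Y;\mathbb R^d)$, by $A(w,v):=\int_{\mathcal Y}w_{i,j}C_{ijk\ell}v_{k,\ell}\,dy$. Cell functions, cell stresses and effective tensors (each cell function is the unique element of $H^1_\#(\mathcal Y)$ satisfying the stated identity for all $v\in H^1_\#(\mathcal Y)$; superscripts are loading indices, subscripts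 are components): - $A(\chi^{1k\ell},v)=-\int_{\mathcal Y}C_{k\ell rs}v_{r,s}\,dy$; $\ S^{0,k\ell}_{ij}:=C_{ijpq}\chi^{1k\ell}_{p,q}+C_{ijk\ell}$; $\ C^0_{ijk\ell}:=\langle S^{0,k\ell}_{ij}\rangle$. - $A(\chi^{2k\ell m},v)=\int_{\mathcal Y}\{(S^{0,k\ell}_{mr}-C^0_{k\ell mr})v_r-\chi^{1k\ell}_pC_{pmrs}v_{r,s}\}\,dy$; $\ S^{1,k\ell m}_{ij}:=C_{ijpq}\chi^{2k\ell m}_{p,q}+C_{ijpm}\chi^{1k\ell}_p$; $\ C^1_{ijk\ell m}:=\langle S^{1,k\ell m}_{ij}\rangle$. - $A(\chi^{3k\ell mn},v)=\int_{\mathcal Y}\{(S^{1,k\ell m}_{rn}-C^1_{rnk\ell m})v_r-\chi^{2k\ell m}_pC_{pnrs}v_{r,s}\}\,dy$; $\ C^2_{ijnk\ell m}:=\langle C_{ijpq}(\chi^{3k\ell mn}_{p,q}+\chi^{2k\ell m}_p\delta_{qn})\rangle$. *)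

theory Defs
  imports "HOL-Analysis.Analysis"
begin

section \<open>Lattice and periodicity cell\<close>

definition lattice :: "('d::finite \<Rightarrow> real ^ 'd) \<Rightarrow> (real ^ 'd) set" where
  "lattice b = {(\<Sum>i\<in>UNIV. real_of_int (n i) *\<^sub>R b i) | n. True}"

definition is_basis :: "('d::finite \<Rightarrow> real ^ 'd) \<Rightarrow> bool" where
  "is_basis b \<longleftrightarrow> inj b \<and> independent (range b) \<and> span (range b) = UNIV"

definition periodicity_cell :: "('d::finite \<Rightarrow> real ^ 'd) \<Rightarrow> (real ^ 'd) set \<Rightarrow> bool" where
  "periodicity_cell b Y \<longleftrightarrow>
     is_basis b \<and> open Y \<and> bounded Y \<and> frontier Y \<in> null_sets lebesgue \<and>
     (\<forall>V\<in>lattice b. \<forall>W\<in>lattice b. V \<noteq> W \<longrightarrow> (+) V ` Y \<inter> (+) W ` Y = {}) \<and>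
     (\<Union>V\<in>lattice b. closure ((+) V ` Y)) = UNIV"

definition cell_mean :: "(real ^ 'd::finite) set \<Rightarrow> (real ^ 'd \<Rightarrow> real) \<Rightarrow> real" where
  "cell_mean Y f = (1 / measure lebesgue Y) * (LINT y|lebesgue_on Y. f y)"


section \<open>Elasticity tensors\<close>

text \<open>
  The coefficients are representatives of classes in $L^\infty(Y)$, so boundedness, the symmetries
  and ellipticity are required almost everywhere. The norm on matrices of type
  \<^typ>\<open>real ^ 'd ^ 'd\<close> is the Frobenius norm.
\<close>

definition elasticity_tensor ::
  "(real ^ 'd::finite) set \<Rightarrow> ('d \<Rightarrow> 'd \<Rightarrow> 'd \<Rightarrow> 'd \<Rightarrow> real ^ 'd \<Rightarrow> real) \<Rightarrow> bool" where
  "elasticity_tensor Y C \<longleftrightarrow>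
     (\<forall>i j k l. C i j k l \<in> borel_measurable (lebesgue_on Y)) \<and>
     (\<forall>i j k l. \<exists>M. AE y in lebesgue_on Y. \<bar>C i j k l y\<bar> \<le> M) \<and>
     (\<forall>i j k l. AE y in lebesgue_on Y.
        C i j k l y = C j i k l y \<and> C i j k l y = C i j l k y \<and> C i j k l y = C k l i j y) \<and>
     (\<exists>\<kappa>>0. AE y in lebesgue_on Y. \<forall>\<epsilon> :: real ^ 'd ^ 'd. transpose \<epsilon> = \<epsilon> \<longrightarrow>
        \<kappa> * (norm \<epsilon>)\<^sup>2 \<le>
          (\<Sum>i\<in>UNIV. \<Sum>j\<in>UNIV. \<Sum>k\<in>UNIV. \<Sum>l\<in>UNIV. \<epsilon> $ i $ j * C i j k l y * \<epsilon> $ k $ l))"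


section \<open>Smooth functions\<close>

definition partial :: "'d::finite \<Rightarrow> (real ^ 'd \<Rightarrow> real) \<Rightarrow> real ^ 'd \<Rightarrow> real" where
  "partial i f x = frechet_derivative f (at x) (axis i 1)"

primrec Ck :: "nat \<Rightarrow> (real ^ 'd::finite \<Rightarrow> real) \<Rightarrow> bool" where
  "Ck 0 f \<longleftrightarrow> continuous_on UNIV f"
| "Ck (Suc k) f \<longleftrightarrow> (\<forall>x. f differentiable (at x)) \<and> (\<forall>i. Ck k (partial i f))"

definition smooth :: "(real ^ 'd::finite \<Rightarrow> real) \<Rightarrow> bool" where
  "smooth f \<longleftrightarrow> (\<forall>k. Ck k f)"

definition test_function :: "(real ^ 'd::finite) set \<Rightarrow> (real ^ 'd \<Rightarrow> real) \<Rightarrow> bool" where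
  "test_function Y \<phi> \<longleftrightarrow>
     smooth \<phi> \<and> compact (closure {x. \<phi> x \<noteq> 0}) \<and> closure {x. \<phi> x \<noteq> 0} \<subseteq> Y"

definition smooth_periodic ::
  "('d::finite \<Rightarrow> real ^ 'd) \<Rightarrow> (real ^ 'd \<Rightarrow> real ^ 'd) \<Rightarrow> bool" where
  "smooth_periodic b \<phi> \<longleftrightarrow>
     (\<forall>p. smooth (\<lambda>x. \<phi> x $ p)) \<and> (\<forall>V\<in>lattice b. \<forall>x. \<phi> (x + V) = \<phi> x)"


section \<open>Sobolev spaces\<close>

text \<open>
  Elements of $L^2$ and $H^1$ are represented by functions rather than by classes modulo equality
  almost everywhere; values outside \<open>Y\<close> are irrelevant.
\<close>

definition L2 :: "(real ^ 'd::finite) set \<Rightarrow> (real ^ 'd \<Rightarrow> real) set" where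
  "L2 Y = {f \<in> borel_measurable (lebesgue_on Y). integrable (lebesgue_on Y) (\<lambda>y. (f y)\<^sup>2)}"

definition has_weak_partial ::
  "(real ^ 'd::finite) set \<Rightarrow> 'd \<Rightarrow> (real ^ 'd \<Rightarrow> real) \<Rightarrow> (real ^ 'd \<Rightarrow> real) \<Rightarrow> bool" where
  "has_weak_partial Y i f g \<longleftrightarrow>
     f \<in> L2 Y \<and> g \<in> L2 Y \<and>
     (\<forall>\<phi>. test_function Y \<phi> \<longrightarrow>
        (LINT y|lebesgue_on Y. f y * partial i \<phi> y) = - (LINT y|lebesgue_on Y. g y * \<phi> y))"

definition H1 :: "(real ^ 'd::finite) set \<Rightarrow> (real ^ 'd \<Rightarrow> real ^ 'd) set" where
  "H1 Y = {u. \<forall>p i. \<exists>g. has_weak_partial Y i (\<lambda>y. u y $ p) g}"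

text \<open>
  \<open>wD Y u p q\<close> is $u_{p,q}$, the weak derivative of the \<open>p\<close>-th component in direction \<open>q\<close>. It is
  unique only up to null sets, hence the choice of a representative; it is meaningful only
  for \<open>u \<in> H1 Y\<close>.
\<close>

definition wD ::
  "(real ^ 'd::finite) set \<Rightarrow> (real ^ 'd \<Rightarrow> real ^ 'd) \<Rightarrow> 'd \<Rightarrow> 'd \<Rightarrow> real ^ 'd \<Rightarrow> real" where
  "wD Y u p q = (SOME g. has_weak_partial Y q (\<lambda>y. u y $ p) g)"

definition H1_norm :: "(real ^ 'd::finite) set \<Rightarrow> (real ^ 'd \<Rightarrow> real ^ 'd) \<Rightarrow> real" where
  "H1_norm Y u =
     sqrt (LINT y|lebesgue_on Y.
       (\<Sum>p\<in>UNIV. (u y $ p)\<^sup>2) + (\<Sum>p\<in>UNIV. \<Sum>q\<in>UNIV. (wD Y u p q y)\<^sup>2))"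

definition H1_per ::
  "('d::finite \<Rightarrow> real ^ 'd) \<Rightarrow> (real ^ 'd) set \<Rightarrow> (real ^ 'd \<Rightarrow> real ^ 'd) set" where
  "H1_per b Y =
     {u \<in> H1 Y. \<forall>e>0. \<exists>\<phi>. smooth_periodic b \<phi> \<and> H1_norm Y (\<lambda>y. u y - \<phi> y) < e}"

definition H1_sharp ::
  "('d::finite \<Rightarrow> real ^ 'd) \<Rightarrow> (real ^ 'd) set \<Rightarrow> (real ^ 'd \<Rightarrow> real ^ 'd) set" where
  "H1_sharp b Y = {u \<in> H1_per b Y. \<forall>p. cell_mean Y (\<lambda>y. u y $ p) = 0}"

definition bform ::
  "(real ^ 'd::finite) set \<Rightarrow> ('d \<Rightarrow> 'd \<Rightarrow> 'd \<Rightarrow> 'd \<Rightarrow> real ^ 'd \<Rightarrow> real) \<Rightarrow>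
   (real ^ 'd \<Rightarrow> real ^ 'd) \<Rightarrow> (real ^ 'd \<Rightarrow> real ^ 'd) \<Rightarrow> real" where
  "bform Y C w v =
     (LINT y|lebesgue_on Y.
        (\<Sum>i\<in>UNIV. \<Sum>j\<in>UNIV. \<Sum>k\<in>UNIV. \<Sum>l\<in>UNIV. wD Y w i j y * C i j k l y * wD Y v k l y))"


section \<open>Cell functions, cell stresses and effective tensors\<close>

text \<open>
  In \<open>\<chi>1 k l\<close>, \<open>\<chi>2 k l m\<close>, \<open>\<chi>3 k l m n\<close> the arguments are the loading indices. In \<open>S0\<close> and \<open>S1\<close>
  the loading indices come first and the component indices last, so that
  \<open>S0 Y C \<chi>1 k l i j\<close> is $S^{0,k\ell}_{ij}$ and \<open>S1 Y C \<chi>1 \<chi>2 k l m i j\<close> is $S^{1,k\ell m}_{ij}$.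
  The effective tensors take their indices in the order in which they are written as subscripts.
\<close>

type_synonym 'd tensor_field = "'d \<Rightarrow> 'd \<Rightarrow> 'd \<Rightarrow> 'd \<Rightarrow> real ^ 'd \<Rightarrow> real"
type_synonym 'd cellfun1 = "'d \<Rightarrow> 'd \<Rightarrow> real ^ 'd \<Rightarrow> real ^ 'd"
type_synonym 'd cellfun2 = "'d \<Rightarrow> 'd \<Rightarrow> 'd \<Rightarrow> real ^ 'd \<Rightarrow> real ^ 'd"
type_synonym 'd cellfun3 = "'d \<Rightarrow> 'd \<Rightarrow> 'd \<Rightarrow> 'd \<Rightarrow> real ^ 'd \<Rightarrow> real ^ 'd"

definition first_cell_functions ::
  "('d::finite \<Rightarrow> real ^ 'd) \<Rightarrow> (real ^ 'd) set \<Rightarrow> 'd tensor_field \<Rightarrow> 'd cellfun1 \<Rightarrow> bool" where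
  "first_cell_functions b Y C \<chi>1 \<longleftrightarrow>
     (\<forall>k l. \<chi>1 k l \<in> H1_sharp b Y \<and>
       (\<forall>v\<in>H1_sharp b Y.
          bform Y C (\<chi>1 k l) v =
            - (LINT y|lebesgue_on Y. (\<Sum>r\<in>UNIV. \<Sum>s\<in>UNIV. C k l r s y * wD Y v r s y))))"

definition S0 ::
  "(real ^ 'd::finite) set \<Rightarrow> 'd tensor_field \<Rightarrow> 'd cellfun1 \<Rightarrow>
   'd \<Rightarrow> 'd \<Rightarrow> 'd \<Rightarrow> 'd \<Rightarrow> real ^ 'd \<Rightarrow> real" where
  "S0 Y C \<chi>1 k l i j y =
     (\<Sum>p\<in>UNIV. \<Sum>q\<in>UNIV. C i j p q y * wD Y (\<chi>1 k l) p q y) + C i j k l y"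

definition C0 ::
  "(real ^ 'd::finite) set \<Rightarrow> 'd tensor_field \<Rightarrow> 'd cellfun1 \<Rightarrow> 'd \<Rightarrow> 'd \<Rightarrow> 'd \<Rightarrow> 'd \<Rightarrow> real" where
  "C0 Y C \<chi>1 i j k l = cell_mean Y (S0 Y C \<chi>1 k l i j)"

definition second_cell_functions ::
  "('d::finite \<Rightarrow> real ^ 'd) \<Rightarrow> (real ^ 'd) set \<Rightarrow> 'd tensor_field \<Rightarrow>
   'd cellfun1 \<Rightarrow> 'd cellfun2 \<Rightarrow> bool" where
  "second_cell_functions b Y C \<chi>1 \<chi>2 \<longleftrightarrow>
     (\<forall>k l m. \<chi>2 k l m \<in> H1_sharp b Y \<and>
       (\<forall>v\<in>H1_sharp b Y.
          bform Y C (\<chi>2 k l m) v =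
            (LINT y|lebesgue_on Y.
               (\<Sum>r\<in>UNIV. (S0 Y C \<chi>1 k l m r y - C0 Y C \<chi>1 k l m r) * v y $ r)
               - (\<Sum>p\<in>UNIV. \<Sum>r\<in>UNIV. \<Sum>s\<in>UNIV. \<chi>1 k l y $ p * C p m r s y * wD Y v r s y))))"

definition S1 ::
  "(real ^ 'd::finite) set \<Rightarrow> 'd tensor_field \<Rightarrow> 'd cellfun1 \<Rightarrow> 'd cellfun2 \<Rightarrow>
   'd \<Rightarrow> 'd \<Rightarrow> 'd \<Rightarrow> 'd \<Rightarrow> 'd \<Rightarrow> real ^ 'd \<Rightarrow> real" where
  "S1 Y C \<chi>1 \<chi>2 k l m i j y =
     (\<Sum>p\<in>UNIV. \<Sum>q\<in>UNIV. C i j p q y * wD Y (\<chi>2 k l m) p q y)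
     + (\<Sum>p\<in>UNIV. C i j p m y * \<chi>1 k l y $ p)"

definition C1 ::
  "(real ^ 'd::finite) set \<Rightarrow> 'd tensor_field \<Rightarrow> 'd cellfun1 \<Rightarrow> 'd cellfun2 \<Rightarrow>
   'd \<Rightarrow> 'd \<Rightarrow> 'd \<Rightarrow> 'd \<Rightarrow> 'd \<Rightarrow> real" where
  "C1 Y C \<chi>1 \<chi>2 i j k l m = cell_mean Y (S1 Y C \<chi>1 \<chi>2 k l m i j)"

definition third_cell_functions ::
  "('d::finite \<Rightarrow> real ^ 'd) \<Rightarrow> (real ^ 'd) set \<Rightarrow> 'd tensor_field \<Rightarrow>
   'd cellfun1 \<Rightarrow> 'd cellfun2 \<Rightarrow> 'd cellfun3 \<Rightarrow> bool" where
  "third_cell_functions b Y C \<chi>1 \<chi>2 \<chi>3 \<longleftrightarrow>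
     (\<forall>k l m n. \<chi>3 k l m n \<in> H1_sharp b Y \<and>
       (\<forall>v\<in>H1_sharp b Y.
          bform Y C (\<chi>3 k l m n) v =
            (LINT y|lebesgue_on Y.
               (\<Sum>r\<in>UNIV. (S1 Y C \<chi>1 \<chi>2 k l m r n y - C1 Y C \<chi>1 \<chi>2 r n k l m) * v y $ r)
               - (\<Sum>p\<in>UNIV. \<Sum>r\<in>UNIV. \<Sum>s\<in>UNIV. \<chi>2 k l m y $ p * C p n r s y * wD Y v r s y))))"

definition C2 ::
  "(real ^ 'd::finite) set \<Rightarrow> 'd tensor_field \<Rightarrow> 'd cellfun2 \<Rightarrow> 'd cellfun3 \<Rightarrow>
   'd \<Rightarrow> 'd \<Rightarrow> 'd \<Rightarrow> 'd \<Rightarrow> 'd \<Rightarrow> 'd \<Rightarrow> real" where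
  "C2 Y C \<chi>2 \<chi>3 i j n k l m =
     cell_mean Y (\<lambda>y. \<Sum>p\<in>UNIV. \<Sum>q\<in>UNIV.
       C i j p q y * (wD Y (\<chi>3 k l m n) p q y + \<chi>2 k l m y $ p * (if q = n then 1 else 0)))"

definition P_field :: "'d::finite \<Rightarrow> 'd \<Rightarrow> real ^ 'd \<Rightarrow> real ^ 'd" where
  "P_field i j x = (1 / 2) *\<^sub>R (x $ i *\<^sub>R axis j 1 + x $ j *\<^sub>R axis i 1)"

end

theory Submission
  imports Defs
begin

text \<open>
Each effective tensor is, up to the factor $1/|Y|$, an integral over the cell. For $C^1$ and $C^2$
it contains the gradient of a cell function of one order more than the formula to be proved
allows. The superfluous order is removed by reciprocity: the problem for $\chi^{1ij}$ tested with the
superfluous cell function $w$ shows that $\int C_{ijrs} w_{r,s} = -A(\chi^{1ij}, w)$; the form $A$ is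
symmetric; and the problem for $w$ tested with $\chi^{1ij}$ expresses $A(w, \chi^{1ij})$ by data of lower
order, where the constants that balance the load drop out because $\chi^{1ij}$ has mean zero. This is
\<open>integral_stress_reciprocity\<close>. With $w = \chi^{2k\ell m}$ it is already the formula for $C^1$. With
$w = \chi^{3k\ell mn}$ one more identity is used, the problem for $\chi^{2ijn}$ tested with
$\chi^{2k\ell m}$. For $C^0$ the energy of $\chi^{1ij} + P^{ij}$ and $\chi^{1k\ell} + P^{k\ell}$ is
expanded (\<open>bform_add_P_field\<close>), and the first cell problem removes all terms that contain
$\chi^{1ij}$.

The analytic content lies in this last expansion. Since \<^const>\<open>wD\<close> chooses some weak derivative, the gradient of
$\chi^{1ij} + P^{ij}$ is known to be the sum of the gradients only once weak derivatives are unique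
almost everywhere and the linear field $P^{ij}$ is integrated by parts against test functions. The
former (\<open>has_weak_partial_unique\<close>) needs enough test functions, which are built from $e^{-1/t}$,
and Lebesgue's differentiation theorem. The latter (\<open>smooth_has_weak_partial\<close>) follows from
translation invariance of Lebesgue measure. The remaining integrals exist because all fields
involved are square-integrable and $C$ is bounded.
\<close>

section \<open>Calculus of smooth functions\<close>

lemma partial_eqI: "(f has_derivative f') (at x) \<Longrightarrow> partial i f x = f' (axis i 1)"
  unfolding partial_def by (metis frechet_derivative_at)

lemma Ck_Suc_imp_Ck: "Ck (Suc k) f \<Longrightarrow> Ck k f"
proof (induction k arbitrary: f)
  case 0
  then show ?case
    by (auto intro!: continuous_at_imp_continuous_on differentiable_imp_continuous_within)
qed auto

lemma Ck_const: "Ck k (\<lambda>x. c)"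
proof (induction k arbitrary: c)
  case (Suc k)
  have "partial i (\<lambda>x. c) = (\<lambda>x. 0)" for i :: 'a
    by (rule ext, rule partial_eqI[where f' = "\<lambda>h. 0"]) auto
  then show ?case using Suc by simp
qed auto

lemma partial_add:
  "f differentiable at x \<Longrightarrow> g differentiable at x \<Longrightarrow>
    partial i (\<lambda>x. f x + g x) x = partial i f x + partial i g x"
  unfolding partial_def frechet_derivative_works
  by (subst frechet_derivative_at[symmetric, OF has_derivative_add]) auto

lemma partial_mult:
  "f differentiable at x \<Longrightarrow> g differentiable at x \<Longrightarrow>
    partial i (\<lambda>x. f x * g x) x = f x * partial i g x + partial i f x * g x"
  unfolding partial_def frechet_derivative_works
  by (subst frechet_derivative_at[symmetric, OF has_derivative_mult]) auto

lemma Ck_add: "Ck k f \<Longrightarrow> Ck k g \<Longrightarrow> Ck k (\<lambda>x. f x + g x)"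
proof (induction k arbitrary: f g)
  case 0
  then show ?case by (auto intro: continuous_intros)
next
  case (Suc k)
  then have "partial i (\<lambda>x. f x + g x) = (\<lambda>x. partial i f x + partial i g x)" for i
    by (auto simp: partial_add)
  then show ?case using Suc by auto
qed

text \<open>
The product rule makes the derivative of a $C^{k+1}$ product a sum of products with one factor
differentiated and the other not, hence the detour through \<open>Ck_Suc_imp_Ck\<close>.
\<close>
lemma Ck_mult: "Ck k f \<Longrightarrow> Ck k g \<Longrightarrow> Ck k (\<lambda>x. f x * g x)"
proof (induction k arbitrary: f g)
  case 0
  then show ?case by (auto intro: continuous_intros)
next
  case (Suc k)
  then have "partial i (\<lambda>x. f x * g x) = (\<lambda>x. f x * partial i g x + partial i f x * g x)" for i
    by (auto simp: partial_mult)
  moreover have "Ck k f" "Ck k g" using Suc.prems Ck_Suc_imp_Ck by blast+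
  ultimately show ?case using Suc by (auto intro!: Ck_add)
qed

lemma smooth_const: "smooth (\<lambda>x. c)"
  by (simp add: smooth_def Ck_const)

lemma smooth_mult: "smooth f \<Longrightarrow> smooth g \<Longrightarrow> smooth (\<lambda>x. f x * g x)"
  by (simp add: smooth_def Ck_mult)

lemma smooth_prod:
  "finite I \<Longrightarrow> (\<And>i. i \<in> I \<Longrightarrow> smooth (f i)) \<Longrightarrow> smooth (\<lambda>x. \<Prod>i\<in>I. f i x)"
  by (induction I rule: finite_induct) (auto simp: smooth_const intro!: smooth_mult)

lemma smooth_differentiable: "smooth f \<Longrightarrow> f differentiable at x"
  unfolding smooth_def by (metis Ck.simps(2))

lemma smooth_continuous: "smooth f \<Longrightarrow> continuous_on UNIV f"
  unfolding smooth_def by (metis Ck.simps(1))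

lemma smooth_partial: "smooth f \<Longrightarrow> smooth (partial i f)"
  unfolding smooth_def by (metis Ck.simps(2))

lemma partial_coordinate: "partial q (\<lambda>x. x $ i) x = (if q = i then 1 else 0)"
  by (subst partial_eqI[where f' = "\<lambda>h. h $ i"])
     (auto simp: axis_def intro: bounded_linear_imp_has_derivative)

lemma smooth_coordinate: "smooth (\<lambda>x. x $ i)"
  unfolding smooth_def
proof
  fix k show "Ck k (\<lambda>x::real^'a. x $ i)"
  proof (cases k)
    case 0
    then show ?thesis by (auto intro: continuous_intros)
  next
    case (Suc l)
    have "(\<lambda>x::real^'a. x $ i) differentiable at x" for x
      by (auto intro!: bounded_linear_imp_differentiable)
    moreover have "partial q (\<lambda>x::real^'a. x $ i) = (\<lambda>x. if q = i then 1 else 0)" for q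
      by (rule ext) (rule partial_coordinate)
    ultimately show ?thesis using Suc by (simp add: Ck_const)
  qed
qed

section \<open>A smooth function that vanishes on a half-line\<close>

text \<open>
The member $m = 0$ is Cauchy's function $e^{-1/t}$, which is smooth but vanishes for $t \le 0$.
The powers of $1/t$ are included because they are what differentiation produces.
\<close>
definition flat :: "nat \<Rightarrow> real \<Rightarrow> real" where
  "flat m t = (if t \<le> 0 then 0 else inverse t ^ m * exp (- inverse t))"

lemma flat_tendsto_0: "(flat m \<longlongrightarrow> 0) (at_right 0)"
proof -
  have "((\<lambda>t. inverse t ^ m / exp (inverse t)) \<longlongrightarrow> (0::real)) (at_right 0)"
    by (rule filterlim_compose[OF tendsto_power_div_exp_0 filterlim_inverse_at_top_right])
  then show ?thesis
    by (rule Lim_transform_eventually)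
       (auto simp: flat_def eventually_at_filter exp_minus field_simps)
qed

text \<open>
Only $t = 0$ needs an argument: from the right the difference quotient of \<^term>\<open>flat m\<close> at $0$ is
\<^term>\<open>flat (Suc m)\<close>, which tends to $0$ because the exponential beats every power.
\<close>
lemma flat_has_derivative:
  "(flat m has_real_derivative flat (m + 2) t + (- real m) * flat (m + 1) t) (at t)"
proof -
  consider "t < 0" | "t > 0" | "t = 0" by linarith
  then show ?thesis
  proof cases
    case 1
    have "((\<lambda>t. 0) has_real_derivative 0) (at t)" by simp
    then have "(flat m has_real_derivative 0) (at t)"
      by (rule has_field_derivative_transform_within_open[where S = "{..<0}"])
         (use 1 in \<open>auto simp: flat_def\<close>)
    then show ?thesis using 1 by (simp add: flat_def)
  next
    case 2
    have "((\<lambda>t. inverse t ^ m * exp (- inverse t)) has_real_derivative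
        inverse t ^ (m + 2) * exp (- inverse t) - real m * (inverse t ^ (m + 1) * exp (- inverse t))) (at t)"
      by (rule derivative_eq_intros refl | use 2 in \<open>simp; fail\<close>)+
         (use 2 in \<open>cases m; simp add: field_simps\<close>)
    then have "(flat m has_real_derivative
        inverse t ^ (m + 2) * exp (- inverse t) - real m * (inverse t ^ (m + 1) * exp (- inverse t))) (at t)"
      by (rule has_field_derivative_transform_within_open[where S = "{0<..}"])
         (use 2 in \<open>auto simp: flat_def\<close>)
    then show ?thesis using 2 by (simp add: flat_def)
  next
    case 3
    have "((\<lambda>h. flat m h / h) \<longlongrightarrow> 0) (at_right 0)"
      by (rule Lim_transform_eventually[OF flat_tendsto_0[of "Suc m"]])
         (auto simp: flat_def eventually_at_filter field_simps)
    moreover have "((\<lambda>h. flat m h / h) \<longlongrightarrow> 0) (at_left 0)"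
      by (rule tendsto_eventually) (auto simp: flat_def eventually_at_filter)
    ultimately have "((\<lambda>h. flat m h / h) \<longlongrightarrow> 0) (at 0)"
      by (simp add: filterlim_split_at_real)
    then show ?thesis using 3 by (simp add: DERIV_def flat_def)
  qed
qed

text \<open>
The derivative of \<^term>\<open>flat m\<close> is a linear combination of \<^term>\<open>flat (m + 1)\<close> and \<^term>\<open>flat (m + 2)\<close>,
so the family is closed under differentiation, and one induction over the order of
differentiability treats all its members simultaneously.
\<close>
lemma smooth_flat_affine: "smooth (\<lambda>x. flat m (c * x $ i + e))"
proof -
  have deriv: "((\<lambda>x::real^'a. flat m (c * x $ i + e)) has_derivative
      (\<lambda>h. (c * h $ i) * (flat (m + 2) (c * x $ i + e) + (- real m) * flat (m + 1) (c * x $ i + e)))) (at x)"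
    for m x
  proof -
    have "((\<lambda>x::real^'a. c * x $ i + e) has_derivative (\<lambda>h. c * h $ i)) (at x)"
      by (auto intro!: derivative_eq_intros bounded_linear_imp_has_derivative)
    from has_derivative_compose[OF this flat_has_derivative[unfolded has_field_derivative_def]]
    show ?thesis by (simp add: mult_ac)
  qed
  have "Ck k (\<lambda>x::real^'a. flat m (c * x $ i + e))" for k
  proof (induction k arbitrary: m)
    case 0
    show ?case
      using deriv has_derivative_continuous by (auto intro!: continuous_at_imp_continuous_on) blast
  next
    case (Suc k)
    have "partial q (\<lambda>x. flat m (c * x $ i + e)) = (\<lambda>x. (c * (if q = i then 1 else 0)) *
      (flat (m + 2) (c * x $ i + e) + (- real m) * flat (m + 1) (c * x $ i + e)))" for q
      by (rule ext, subst partial_eqI[OF deriv]) (simp add: axis_def)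
    moreover have "(\<lambda>x::real^'a. flat m (c * x $ i + e)) differentiable at x" for x
      using deriv by (rule differentiableI)
    ultimately show ?case
      unfolding Ck.simps by (simp only:) (intro conjI allI Ck_mult Ck_add Ck_const Suc.IH TrueI)
  qed
  then show ?thesis by (simp add: smooth_def)
qed

section \<open>Integrals of partial derivatives\<close>

lemma partial_eq_0_outside_support:
  assumes "x \<notin> closure {x. f x \<noteq> 0}"
  shows "partial q f x = 0"
proof -
  have "((\<lambda>x. 0) has_derivative (\<lambda>h. 0)) (at x)" by simp
  then have "(f has_derivative (\<lambda>h. 0)) (at x)"
    by (rule has_derivative_transform_within_open[where s = "- closure {x. f x \<noteq> 0}"])
       (use assms closure_subset[of "{x. f x \<noteq> 0}"] in auto)
  then show ?thesis by (rule partial_eqI)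
qed

lemma directional_has_partial:
  assumes "f differentiable at (x + t *\<^sub>R axis q 1)"
  shows "((\<lambda>t. f (x + t *\<^sub>R axis q 1)) has_real_derivative
            partial q f (x + t *\<^sub>R axis q 1)) (at t)"
proof -
  let ?f' = "frechet_derivative f (at (x + t *\<^sub>R axis q 1))"
  have f': "(f has_derivative ?f') (at (x + t *\<^sub>R axis q 1))"
    using assms frechet_derivative_works by blast
  have "((\<lambda>t. x + t *\<^sub>R axis q 1) has_derivative (\<lambda>h. h *\<^sub>R axis q 1)) (at t)"
    by (auto intro!: derivative_eq_intros)
  from has_derivative_compose[OF this f'] show ?thesis
    unfolding has_field_derivative_def
    by (rule has_derivative_eq_rhs)
       (simp add: partial_def linear_cmul[OF linear_frechet_derivative[OF assms]] fun_eq_iff)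
qed

lemma lborel_integral_translate:
  fixes f :: "'a::euclidean_space \<Rightarrow> real"
  assumes "f \<in> borel_measurable borel"
  shows "(\<integral>x. f (x + a) \<partial>lborel) = (\<integral>x. f x \<partial>lborel)"
proof -
  have "(\<integral>x. f x \<partial>lborel) = (\<integral>x. f x \<partial>distr lborel borel ((+) a))"
    by (simp add: lborel_distr_plus)
  also have "\<dots> = (\<integral>x. f (x + a) \<partial>lborel)"
    using assms by (simp add: integral_distr add.commute)
  finally show ?thesis ..
qed

lemma integrable_lborel_compact_support:
  fixes f :: "'a::euclidean_space \<Rightarrow> real"
  assumes "continuous_on UNIV f" "compact S" "\<And>x. x \<notin> S \<Longrightarrow> f x = 0"
  shows "integrable lborel f"
proof -
  have "integrable lborel (\<lambda>x. indicator S x *\<^sub>R f x)"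
    using assms by (intro borel_integrable_compact continuous_on_subset[OF assms(1)]) auto
  also have "(\<lambda>x. indicator S x *\<^sub>R f x) = f"
    using assms(3) by (auto simp: indicator_def fun_eq_iff)
  finally show ?thesis .
qed

text \<open>
The divergence theorem without a boundary. Translation invariance of Lebesgue measure makes the
integral of every difference quotient of \<open>f\<close> vanish. The quotients converge pointwise to the
partial derivative; by the mean value theorem they are bounded by its maximum, and for steps of
length at most $1$ they live on one compact set, so dominated convergence applies.
\<close>
lemma integral_partial_compact_support:
  assumes "smooth f" and "compact (closure {x. f x \<noteq> 0})"
  shows "(\<integral>x. partial q f x \<partial>lborel) = 0"
proof -
  let ?e = "axis q 1 :: real^'a" and ?S = "closure {x. f x \<noteq> 0}"
  \<comment> \<open>a compact set that carries all difference quotients with steps of length at most 1\<close>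
  define T where "T = {x + y | x y. x \<in> ?S \<and> y \<in> cball 0 1}"
  have "compact T" unfolding T_def by (rule compact_sums[OF assms(2) compact_cball])
  define h where "h = (\<lambda>n. inverse (real (Suc n)))"
  define g where "g = (\<lambda>n x. (f (x + h n *\<^sub>R ?e) - f x) / h n)"
  have cont: "continuous_on UNIV f" "continuous_on UNIV (partial q f)"
    using assms(1) by (auto intro: smooth_continuous smooth_partial)
  have borel: "f \<in> borel_measurable borel" "partial q f \<in> borel_measurable borel"
    using cont by (auto intro: borel_measurable_continuous_onI)
  have h: "h n > 0" "h n \<le> 1" for n by (auto simp: h_def field_simps)
  have "bounded (partial q f ` ?S)"
    by (intro compact_imp_bounded compact_continuous_image continuous_on_subset[OF cont(2)])
       (use assms in auto)
  then obtain B where "\<And>x. x \<in> ?S \<Longrightarrow> \<bar>partial q f x\<bar> \<le> B" "B > 0"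
    unfolding bounded_pos by auto
  then have B: "\<bar>partial q f x\<bar> \<le> B" for x
    using partial_eq_0_outside_support[of x f q] by (cases "x \<in> ?S") auto
  have deriv: "((\<lambda>t. f (x + t *\<^sub>R ?e)) has_real_derivative partial q f (x + t *\<^sub>R ?e)) (at t)" for x t
    by (rule directional_has_partial) (rule smooth_differentiable[OF assms(1)])
  have int_f: "integrable lborel f"
    by (rule integrable_lborel_compact_support[OF cont(1) assms(2)])
       (use closure_subset[of "{x. f x \<noteq> 0}"] in auto)
  have int_shift: "integrable lborel (\<lambda>x. f (x + a))" for a
  proof -
    have "integrable (distr lborel borel ((+) a)) f" using int_f by (simp add: lborel_distr_plus)
    then show ?thesis using borel by (simp add: integrable_distr_eq add.commute)
  qed
  have "(\<lambda>n. \<integral>x. g n x \<partial>lborel) \<longlonglongrightarrow> (\<integral>x. partial q f x \<partial>lborel)"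
  proof (rule integral_dominated_convergence)
    show "integrable lborel (\<lambda>x. B * indicator T x)"
      using emeasure_bounded_finite[OF compact_imp_bounded[OF \<open>compact T\<close>]] \<open>compact T\<close>
      by (intro integrable_mult_right integrable_real_indicator) (auto simp: compact_imp_closed)
    show "AE x in lborel. (\<lambda>n. g n x) \<longlonglongrightarrow> partial q f x"
    proof (rule AE_I2)
      fix x
      have "((\<lambda>t. (f (x + t *\<^sub>R ?e) - f x) / t) \<longlongrightarrow> partial q f x) (at 0)"
        using deriv[of x 0] by (simp add: DERIV_def)
      moreover have "filterlim h (at 0) sequentially"
        unfolding filterlim_at using LIMSEQ_inverse_real_of_nat by (auto simp: h_def)
      ultimately show "(\<lambda>n. g n x) \<longlonglongrightarrow> partial q f x"
        unfolding g_def by (rule filterlim_compose)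
    qed
    show "AE x in lborel. norm (g n x) \<le> B * indicator T x" for n
    proof (rule AE_I2)
      fix x
      show "norm (g n x) \<le> B * indicator T x"
      proof (cases "x \<in> T")
        case True
        obtain z where "f (x + h n *\<^sub>R ?e) - f (x + 0 *\<^sub>R ?e) = (h n - 0) * partial q f (x + z *\<^sub>R ?e)"
          using MVT2[OF h(1)[of n] deriv, of x] by blast
        then have "g n x = partial q f (x + z *\<^sub>R ?e)"
          using h[of n] by (simp add: g_def)
        then show ?thesis using True B by simp
      next
        case False
        have "x \<in> T" if "x + h n *\<^sub>R ?e \<in> ?S"
          unfolding T_def using that h[of n]
          by (intro CollectI exI[of _ "x + h n *\<^sub>R ?e"] exI[of _ "- h n *\<^sub>R ?e"]) auto
        moreover have "x \<in> T" if "x \<in> ?S"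
          unfolding T_def using that by (intro CollectI exI[of _ x] exI[of _ 0]) auto
        ultimately have "f x = 0" "f (x + h n *\<^sub>R ?e) = 0"
          using False closure_subset[of "{x. f x \<noteq> 0}"] by auto
        then show ?thesis using False by (simp add: g_def)
      qed
    qed
    have [measurable]: "f \<in> borel_measurable borel" by (rule borel)
    show "g n \<in> borel_measurable lborel" for n
      unfolding g_def by measurable
    show "partial q f \<in> borel_measurable lborel" using borel by simp
  qed
  moreover have "(\<integral>x. g n x \<partial>lborel) = 0" for n
    unfolding g_def using int_f int_shift[of "h n *\<^sub>R ?e"]
      lborel_integral_translate[OF borel(1), of "h n *\<^sub>R ?e"]
    by simp
  ultimately have "(\<lambda>n. 0) \<longlonglongrightarrow> (\<integral>x. partial q f x \<partial>lborel)"
    by simp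
  then show ?thesis
    using LIMSEQ_unique tendsto_const by blast
qed

lemma lebesgue_on_integral_supported:
  fixes f :: "real ^ 'd::finite \<Rightarrow> real"
  assumes "open Y" "f \<in> borel_measurable borel" "\<And>x. x \<notin> Y \<Longrightarrow> f x = 0"
  shows "(LINT x|lebesgue_on Y. f x) = (\<integral>x. f x \<partial>lborel)"
proof -
  have "(LINT x|lebesgue_on Y. f x) = (LINT x|lebesgue. indicator Y x *\<^sub>R f x)"
    using assms by (intro integral_restrict_space) auto
  also have "(\<lambda>x. indicator Y x *\<^sub>R f x) = f"
    using assms(3) by (auto simp: indicator_def fun_eq_iff)
  also have "(LINT x|lebesgue. f x) = (\<integral>x. f x \<partial>lborel)"
    using assms by (intro integral_completion) auto
  finally show ?thesis .
qed

lemma test_function_smooth: "test_function Y \<phi> \<Longrightarrow> smooth \<phi>"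
  by (simp add: test_function_def)

lemma test_function_mult:
  assumes "smooth f" "test_function Y \<phi>"
  shows "test_function Y (\<lambda>x. f x * \<phi> x)"
proof -
  have "closure {x. f x * \<phi> x \<noteq> 0} \<subseteq> closure {x. \<phi> x \<noteq> 0}"
    by (intro closure_mono) auto
  moreover have "smooth (\<lambda>x. f x * \<phi> x)"
    by (rule smooth_mult[OF assms(1) test_function_smooth[OF assms(2)]])
  ultimately show ?thesis
    using assms(2) bounded_subset unfolding test_function_def compact_eq_bounded_closed by blast
qed

lemma integral_partial_test_function:
  fixes Y :: "(real ^ 'd::finite) set"
  assumes "open Y" "test_function Y \<phi>"
  shows "(LINT y|lebesgue_on Y. partial q \<phi> y) = 0"
proof -
  have "smooth \<phi>" and supp: "compact (closure {x. \<phi> x \<noteq> 0})" "closure {x. \<phi> x \<noteq> 0} \<subseteq> Y"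
    using assms(2) by (auto simp: test_function_def)
  have "(LINT y|lebesgue_on Y. partial q \<phi> y) = (\<integral>y. partial q \<phi> y \<partial>lborel)"
    using supp(2) partial_eq_0_outside_support[of _ \<phi> q]
    by (intro lebesgue_on_integral_supported assms borel_measurable_continuous_onI
        smooth_continuous smooth_partial \<open>smooth \<phi>\<close>) auto
  also have "\<dots> = 0"
    by (rule integral_partial_compact_support[OF \<open>smooth \<phi>\<close> supp(1)])
  finally show ?thesis .
qed

section \<open>Square-integrable functions\<close>

lemma L2_mult_integrable:
  assumes "f \<in> L2 Y" "g \<in> L2 Y"
  shows "integrable (lebesgue_on Y) (\<lambda>y. f y * g y)"
proof (rule Bochner_Integration.integrable_bound)
  show "integrable (lebesgue_on Y) (\<lambda>y. (f y)\<^sup>2 + (g y)\<^sup>2)"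
    using assms by (auto simp: L2_def)
  have "\<bar>f y * g y\<bar> \<le> (f y)\<^sup>2 + (g y)\<^sup>2" for y
  proof -
    have "2 * (\<bar>f y\<bar> * \<bar>g y\<bar>) \<le> (f y)\<^sup>2 + (g y)\<^sup>2"
      using sum_squares_bound[of "\<bar>f y\<bar>" "\<bar>g y\<bar>"] by simp
    moreover have "0 \<le> \<bar>f y\<bar> * \<bar>g y\<bar>" by simp
    ultimately show ?thesis unfolding abs_mult by linarith
  qed
  then show "AE y in lebesgue_on Y. norm (f y * g y) \<le> norm ((f y)\<^sup>2 + (g y)\<^sup>2)"
    by auto
qed (use assms in \<open>auto simp: L2_def\<close>)

lemma L2_add: "f \<in> L2 Y \<Longrightarrow> g \<in> L2 Y \<Longrightarrow> (\<lambda>y. f y + g y) \<in> L2 Y"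
  using L2_mult_integrable[of f Y g]
  by (auto simp: L2_def power2_sum mult.assoc)

lemma L2_bounded_mult:
  assumes "c \<in> borel_measurable (lebesgue_on Y)" "AE y in lebesgue_on Y. \<bar>c y\<bar> \<le> M" "f \<in> L2 Y"
  shows "(\<lambda>y. c y * f y) \<in> L2 Y"
proof -
  have "integrable (lebesgue_on Y) (\<lambda>y. (c y * f y)\<^sup>2)"
  proof (rule Bochner_Integration.integrable_bound)
    show "integrable (lebesgue_on Y) (\<lambda>y. M\<^sup>2 * (f y)\<^sup>2)"
      using assms by (auto simp: L2_def)
    show "AE y in lebesgue_on Y. norm ((c y * f y)\<^sup>2) \<le> norm (M\<^sup>2 * (f y)\<^sup>2)"
      using assms(2) by eventually_elim
        (auto simp: power_mult_distrib abs_mult intro!: mult_right_mono simp: abs_le_square_iff[symmetric])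
  qed (use assms in \<open>auto simp: L2_def\<close>)
  then show ?thesis using assms by (auto simp: L2_def)
qed

lemma L2_scale: "f \<in> L2 Y \<Longrightarrow> (\<lambda>y. c * f y) \<in> L2 Y"
  by (rule L2_bounded_mult[where M = "\<bar>c\<bar>"]) auto

lemma L2_diff: "f \<in> L2 Y \<Longrightarrow> g \<in> L2 Y \<Longrightarrow> (\<lambda>y. f y - g y) \<in> L2 Y"
  using L2_add[of f Y "\<lambda>y. -1 * g y"] L2_scale[of g Y "-1"] by simp

lemma L2_sum: "finite I \<Longrightarrow> (\<And>i. i \<in> I \<Longrightarrow> f i \<in> L2 Y) \<Longrightarrow> (\<lambda>y. \<Sum>i\<in>I. f i y) \<in> L2 Y"
proof (induction I rule: finite_induct)
  case empty
  then show ?case by (simp add: L2_def)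
next
  case (insert i I)
  then show ?case by (auto intro!: L2_add)
qed

lemma finite_measure_lebesgue_on_bounded_open:
  fixes Y :: "(real ^ 'd::finite) set"
  assumes "open Y" "bounded Y"
  shows "finite_measure (lebesgue_on Y)"
  using assms by (intro finite_measure_lebesgue_on) (auto intro: lmeasurable_open)

lemma L2_const:
  fixes Y :: "(real ^ 'd::finite) set"
  assumes "open Y" "bounded Y"
  shows "(\<lambda>y. c) \<in> L2 Y"
  using finite_measure.integrable_const[OF finite_measure_lebesgue_on_bounded_open[OF assms]]
  by (auto simp: L2_def)

lemma L2_integrable:
  fixes Y :: "(real ^ 'd::finite) set"
  assumes "open Y" "bounded Y" "f \<in> L2 Y"
  shows "integrable (lebesgue_on Y) f"
  using L2_mult_integrable[OF assms(3) L2_const[OF assms(1,2), of 1]] by simp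

lemma L2_continuous:
  fixes f :: "real ^ 'd::finite \<Rightarrow> real"
  assumes "open Y" "bounded Y" "continuous_on UNIV f"
  shows "f \<in> L2 Y"
proof -
  have "bounded (f ` closure Y)"
    using assms by (intro compact_imp_bounded compact_continuous_image)
      (auto intro: continuous_on_subset)
  then obtain M where M: "\<And>y. y \<in> closure Y \<Longrightarrow> \<bar>f y\<bar> \<le> M"
    unfolding bounded_iff by auto
  have "AE y in lebesgue_on Y. \<bar>f y\<bar> \<le> M"
    by (rule AE_I2) (use M closure_subset[of Y] in auto)
  moreover have "f \<in> borel_measurable (lebesgue_on Y)"
    using assms by (intro continuous_imp_measurable_on_sets_lebesgue)
      (auto intro: continuous_on_subset)
  ultimately have "(\<lambda>y. f y * 1) \<in> L2 Y"
    by (intro L2_bounded_mult[where M = M] L2_const assms)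
  then show ?thesis by simp
qed

section \<open>Weak derivatives of sums and of smooth functions\<close>

lemma test_function_L2:
  fixes Y :: "(real ^ 'd::finite) set"
  assumes "open Y" "bounded Y" "test_function Y \<phi>"
  shows "\<phi> \<in> L2 Y" "partial q \<phi> \<in> L2 Y"
  using test_function_smooth[OF assms(3)]
  by (intro L2_continuous[OF assms(1,2)] smooth_continuous smooth_partial; simp)+

text \<open>
Integration by parts: the product of a smooth function and a test function is again a test
function, so the integral of its partial derivative vanishes.
\<close>
lemma smooth_has_weak_partial:
  fixes Y :: "(real ^ 'd::finite) set"
  assumes Y: "open Y" "bounded Y" and "smooth f"
  shows "has_weak_partial Y q f (partial q f)"
  unfolding has_weak_partial_def
proof (intro conjI allI impI)
  show f: "f \<in> L2 Y" "partial q f \<in> L2 Y"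
    using assms by (auto intro!: L2_continuous smooth_continuous smooth_partial)
  fix \<phi> assume \<phi>: "test_function Y \<phi>"
  have "0 = (LINT y|lebesgue_on Y. partial q (\<lambda>x. f x * \<phi> x) y)"
    using integral_partial_test_function[OF Y(1) test_function_mult[OF \<open>smooth f\<close> \<phi>]] by simp
  also have "\<dots> = (LINT y|lebesgue_on Y. f y * partial q \<phi> y + partial q f y * \<phi> y)"
    using assms(3) \<phi> by (simp add: partial_mult smooth_differentiable test_function_smooth)
  also have "\<dots> = (LINT y|lebesgue_on Y. f y * partial q \<phi> y) + (LINT y|lebesgue_on Y. partial q f y * \<phi> y)"
    using f test_function_L2[OF Y \<phi>] by (intro Bochner_Integration.integral_add L2_mult_integrable)
  finally show "(LINT y|lebesgue_on Y. f y * partial q \<phi> y) = - (LINT y|lebesgue_on Y. partial q f y * \<phi> y)"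
    by simp
qed

lemma has_weak_partial_add:
  fixes Y :: "(real ^ 'd::finite) set"
  assumes Y: "open Y" "bounded Y"
    and "has_weak_partial Y q f f'" "has_weak_partial Y q g g'"
  shows "has_weak_partial Y q (\<lambda>y. f y + g y) (\<lambda>y. f' y + g' y)"
  using assms test_function_L2[OF Y]
  by (auto simp: has_weak_partial_def L2_add distrib_right L2_mult_integrable)

section \<open>Uniqueness of weak derivatives\<close>

text \<open>
Since \<open>flat 0 (n * t)\<close> tends to $1$ for $t > 0$ and is $0$ for $t \le 0$, these products are smooth
approximations from below to the indicator function of the open box between \<open>a\<close> and \<open>b\<close>. The
factor is \<^term>\<open>Suc n\<close> rather than \<open>n\<close> so that it never vanishes.
\<close>
definition bump :: "real ^ 'd::finite \<Rightarrow> real ^ 'd \<Rightarrow> nat \<Rightarrow> real ^ 'd \<Rightarrow> real" where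
  "bump a b n x = (\<Prod>i\<in>UNIV.
     flat 0 (real (Suc n) * (x $ i - a $ i)) * flat 0 (real (Suc n) * (b $ i - x $ i)))"

lemma smooth_bump: "smooth (bump a b n)"
proof -
  have "smooth (\<lambda>x. flat 0 (real (Suc n) * x $ i + (- real (Suc n) * a $ i)) *
                    flat 0 ((- real (Suc n)) * x $ i + real (Suc n) * b $ i))" for i
    by (intro smooth_mult smooth_flat_affine)
  then have "smooth (\<lambda>x. \<Prod>i\<in>UNIV. flat 0 (real (Suc n) * x $ i + (- real (Suc n) * a $ i)) *
                    flat 0 ((- real (Suc n)) * x $ i + real (Suc n) * b $ i))"
    by (intro smooth_prod) auto
  moreover have "real (Suc n) * s + (- real (Suc n) * t) = real (Suc n) * (s - t)"
    "(- real (Suc n)) * s + real (Suc n) * t = real (Suc n) * (t - s)" for s t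
    by (simp_all add: algebra_simps)
  ultimately show ?thesis unfolding bump_def[abs_def] by (simp only:)
qed

lemma flat_0_bounds: "0 \<le> flat 0 t" "flat 0 t \<le> 1"
  by (auto simp: flat_def)

lemma bump_bounds: "0 \<le> bump a b n x" "bump a b n x \<le> 1"
  unfolding bump_def
  by (auto intro!: prod_nonneg prod_le_1 mult_le_one mult_nonneg_nonneg flat_0_bounds)

lemma bump_eq_0:
  assumes "x \<notin> box a b"
  shows "bump a b n x = 0"
proof -
  obtain i where "x $ i \<le> a $ i \<or> b $ i \<le> x $ i"
    using assms by (auto simp: mem_box_cart not_less)
  then have "flat 0 (real (Suc n) * (x $ i - a $ i)) * flat 0 (real (Suc n) * (b $ i - x $ i)) = 0"
    by (auto simp: flat_def mult_le_0_iff)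
  then show ?thesis unfolding bump_def by (intro prod_zero) auto
qed

lemma test_function_bump:
  assumes "cbox a b \<subseteq> Y"
  shows "test_function Y (bump a b n)"
proof -
  have "{x. bump a b n x \<noteq> 0} \<subseteq> cbox a b"
    using bump_eq_0 box_subset_cbox by blast
  then have "closure {x. bump a b n x \<noteq> 0} \<subseteq> cbox a b"
    by (rule closure_minimal) (rule closed_cbox)
  then show ?thesis
    using assms smooth_bump bounded_subset[OF bounded_cbox]
    unfolding test_function_def compact_eq_bounded_closed by auto
qed

lemma bump_tendsto_indicator: "(\<lambda>n. bump a b n x) \<longlonglongrightarrow> indicator (box a b) x"
proof (cases "x \<in> box a b")
  case True
  have lim: "(\<lambda>n. flat 0 (real (Suc n) * t)) \<longlonglongrightarrow> 1" if "t > 0" for t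
  proof -
    have "(\<lambda>n. exp (- (inverse (real (Suc n)) * inverse t))) \<longlonglongrightarrow> exp (- (0 * inverse t))"
      by (intro tendsto_intros LIMSEQ_inverse_real_of_nat)
    then show ?thesis using that by (simp add: flat_def mult_le_0_iff)
  qed
  have "(\<lambda>n. bump a b n x) \<longlonglongrightarrow> (\<Prod>i\<in>(UNIV::'a set). 1 * 1)"
    unfolding bump_def using True by (intro tendsto_prod tendsto_mult lim) (auto simp: mem_box_cart)
  then show ?thesis using True by simp
qed (simp add: bump_eq_0)

text \<open>
The bumps are admissible test functions and converge boundedly to the indicator of the box.
\<close>
lemma integral_box_eq_0_if_orthogonal_to_test_functions:
  fixes Y :: "(real ^ 'd::finite) set"
  assumes Y: "open Y" "bounded Y" and h: "h \<in> L2 Y"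
    and orth: "\<And>\<phi>. test_function Y \<phi> \<Longrightarrow> (LINT y|lebesgue_on Y. h y * \<phi> y) = 0"
    and "cbox a b \<subseteq> Y"
  shows "(LINT y|lebesgue_on Y. h y * indicator (box a b) y) = 0"
proof -
  have "(\<lambda>n. LINT y|lebesgue_on Y. h y * bump a b n y) \<longlonglongrightarrow>
        (LINT y|lebesgue_on Y. h y * indicator (box a b) y)"
  proof (rule integral_dominated_convergence)
    show "integrable (lebesgue_on Y) (\<lambda>y. \<bar>h y\<bar>)"
      using L2_integrable[OF Y h] by simp
    show "AE y in lebesgue_on Y. (\<lambda>n. h y * bump a b n y) \<longlonglongrightarrow> h y * indicator (box a b) y"
      by (intro AE_I2 tendsto_intros bump_tendsto_indicator)
    show "AE y in lebesgue_on Y. norm (h y * bump a b n y) \<le> \<bar>h y\<bar>" for n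
      using bump_bounds[of a b n] by (auto simp: abs_mult intro!: mult_left_le AE_I2)
    have "indicat_real (box a b) \<in> borel_measurable (lebesgue_on Y)"
      by (intro measurable_restrict_space1 borel_measurable_indicator) auto
    then show "(\<lambda>y. h y * indicator (box a b) y) \<in> borel_measurable (lebesgue_on Y)"
      using h by (auto simp: L2_def)
    show "(\<lambda>y. h y * bump a b n y) \<in> borel_measurable (lebesgue_on Y)" for n
      using L2_mult_integrable[OF h test_function_L2(1)[OF Y test_function_bump[OF assms(5)]]] by auto
  qed
  then show ?thesis
    using orth[OF test_function_bump[OF assms(5)]] by (simp add: LIMSEQ_const_iff)
qed

text \<open>
The fundamental lemma of the calculus of variations. All integrals of \<open>h\<close> over boxes inside \<open>Y\<close>
vanish, and by Lebesgue's differentiation theorem \<open>h\<close> is almost everywhere the limit of its means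
over cubes shrinking to a point.
\<close>
lemma AE_eq_0_if_orthogonal_to_test_functions:
  fixes Y :: "(real ^ 'd::finite) set"
  assumes Y: "open Y" "bounded Y" and h: "h \<in> L2 Y"
    and orth: "\<And>\<phi>. test_function Y \<phi> \<Longrightarrow> (LINT y|lebesgue_on Y. h y * \<phi> y) = 0"
  shows "AE y in lebesgue_on Y. h y = 0"
proof -
  let ?f = "\<lambda>x. if x \<in> Y then h x else 0"
  have int: "integrable lebesgue ?f"
    using L2_integrable[OF Y h] Y Lebesgue_Measure.integrable_restrict_UNIV[of Y h] by simp
  then have "?f integrable_on UNIV"
    by (intro integrable_on_lebesgue_on) (simp_all add: lebesgue_on_UNIV_eq)
  then have HK: "?f integrable_on cbox a b" for a b
    by (rule integrable_on_subcbox) simp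
  have zero: "integral (cbox a b) ?f = 0" if "cbox a b \<subseteq> Y" for a b
  proof -
    have "box a b \<subseteq> Y" using that box_subset_cbox by blast
    have *: "indicator (box a b) x *\<^sub>R ?f x = indicator Y x *\<^sub>R (h x * indicator (box a b) x)" for x
      by (auto simp: indicator_def)
    have "integral (cbox a b) ?f = integral (box a b) ?f"
      by (simp add: integral_open_interval)
    also have "\<dots> = (LINT x|lebesgue_on (box a b). ?f x)"
      using integrable_mult_indicator[OF _ int, of "box a b"]
      by (intro lebesgue_integral_eq_integral[symmetric]) (simp_all add: integrable_restrict_space)
    also have "\<dots> = (LINT x|lebesgue. indicator (box a b) x *\<^sub>R ?f x)"
      by (rule integral_restrict_space) auto
    also have "\<dots> = (LINT x|lebesgue_on Y. h x * indicator (box a b) x)"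
      unfolding * using Y by (subst integral_restrict_space) auto
    also have "\<dots> = 0"
      by (rule integral_box_eq_0_if_orthogonal_to_test_functions[OF Y h orth that])
    finally show ?thesis .
  qed
  obtain N where N: "negligible N"
    "\<And>x e. \<lbrakk>x \<notin> N; 0 < e\<rbrakk> \<Longrightarrow> \<exists>d>0. \<forall>t. 0 < t \<and> t < d \<longrightarrow>
      norm (integral (cbox x (x + t *\<^sub>R One)) ?f /\<^sub>R t ^ DIM(real ^ 'd) - ?f x) < e"
    by (rule integrable_ccontinuous_explicit[OF HK]) blast
  have "h x = 0" if x: "x \<in> Y" "x \<notin> N" for x
  proof (rule ccontr)
    assume "h x \<noteq> 0"
    then obtain d where d: "d > 0" "\<And>t. 0 < t \<Longrightarrow> t < d \<Longrightarrow>
        norm (integral (cbox x (x + t *\<^sub>R One)) ?f /\<^sub>R t ^ DIM(real ^ 'd) - ?f x) < \<bar>h x\<bar>"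
      using N(2)[OF x(2), of "\<bar>h x\<bar>"] by auto
    obtain e where e: "e > 0" "cball x e \<subseteq> Y"
      using Y(1) x(1) open_contains_cball by blast
    let ?O = "One :: real ^ 'd"
    define t where "t = min (d / 2) (e / (norm ?O + 1))"
    have pos: "norm ?O + 1 > 0" by (simp add: add_nonneg_pos)
    have "0 < t" "t < d" "t \<le> e / (norm ?O + 1)"
      using d(1) e(1) pos by (auto simp: t_def)
    then have t: "0 < t" "t < d" "t * (norm ?O + 1) \<le> e"
      using pos by (simp_all add: pos_le_divide_eq)
    \<comment> \<open>no point of the cube is farther from x than the opposite corner\<close>
    have "cbox x (x + t *\<^sub>R ?O) \<subseteq> cball x e"
    proof
      fix y assume y: "y \<in> cbox x (x + t *\<^sub>R ?O)"
      have "norm (y - x) \<le> norm (t *\<^sub>R ?O)"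
        using y t(1) by (intro norm_le_componentwise) (auto simp: mem_box inner_diff_left inner_add_left)
      also have "\<dots> \<le> t * (norm ?O + 1)" using t(1) by (simp add: algebra_simps)
      finally show "y \<in> cball x e" using t(3) by (simp add: dist_norm norm_minus_commute)
    qed
    then have "integral (cbox x (x + t *\<^sub>R ?O)) ?f = 0" using zero e(2) by blast
    then show False using d(2)[OF t(1,2)] x(1) by simp
  qed
  moreover have "AE x in lebesgue. x \<notin> N"
    using N(1) by (auto simp: negligible_iff_null_sets intro: AE_not_in)
  ultimately show ?thesis
    using Y by (subst AE_restrict_space_iff) auto
qed

text \<open>
This is what gives meaning to the choice of a representative in \<^const>\<open>wD\<close>: any weak derivative
found by a calculation agrees with the chosen one almost everywhere.
\<close>
lemma has_weak_partial_unique: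
  fixes Y :: "(real ^ 'd::finite) set"
  assumes Y: "open Y" "bounded Y" and "has_weak_partial Y q f g" "has_weak_partial Y q f g'"
  shows "AE y in lebesgue_on Y. g y = g' y"
proof -
  have g: "g \<in> L2 Y" "g' \<in> L2 Y" using assms by (auto simp: has_weak_partial_def)
  have "AE y in lebesgue_on Y. g y - g' y = 0"
  proof (rule AE_eq_0_if_orthogonal_to_test_functions[OF Y L2_diff[OF g]])
    fix \<phi> assume \<phi>: "test_function Y \<phi>"
    then have "(LINT y|lebesgue_on Y. g y * \<phi> y) = (LINT y|lebesgue_on Y. g' y * \<phi> y)"
      using assms(3,4) by (simp add: has_weak_partial_def)
    then show "(LINT y|lebesgue_on Y. (g y - g' y) * \<phi> y) = 0"
      using g test_function_L2[OF Y \<phi>] by (simp add: left_diff_distrib L2_mult_integrable)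
  qed
  then show ?thesis by simp
qed

section \<open>Gradients of Sobolev functions and of the fields $P^{ij}$\<close>

lemma H1_has_weak_partial_wD:
  assumes "u \<in> H1 Y"
  shows "has_weak_partial Y q (\<lambda>y. u y $ p) (wD Y u p q)"
proof -
  have "\<exists>g. has_weak_partial Y q (\<lambda>y. u y $ p) g" using assms by (simp add: H1_def)
  then show ?thesis unfolding wD_def by (rule someI_ex)
qed

lemma H1_component_L2: "u \<in> H1 Y \<Longrightarrow> (\<lambda>y. u y $ p) \<in> L2 Y"
  using H1_has_weak_partial_wD unfolding has_weak_partial_def by blast

lemma H1_wD_L2: "u \<in> H1 Y \<Longrightarrow> wD Y u p q \<in> L2 Y"
  using H1_has_weak_partial_wD unfolding has_weak_partial_def by blast

lemma H1_sharp_imp_H1: "u \<in> H1_sharp b Y \<Longrightarrow> u \<in> H1 Y"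
  by (simp add: H1_sharp_def H1_per_def)

lemma wD_AE_eq:
  fixes Y :: "(real ^ 'd::finite) set"
  assumes "open Y" "bounded Y" "has_weak_partial Y q (\<lambda>y. u y $ p) g"
  shows "AE y in lebesgue_on Y. wD Y u p q y = g y"
proof -
  have "has_weak_partial Y q (\<lambda>y. u y $ p) (wD Y u p q)"
    unfolding wD_def by (rule someI[of _ g]) (rule assms(3))
  then show ?thesis by (rule has_weak_partial_unique[OF assms(1,2) _ assms(3)])
qed

text \<open>
The gradient of \<^term>\<open>P_field i j\<close>, that is, the symmetrised matrix unit
$\frac12 (e_i \otimes e_j + e_j \otimes e_i)$.
\<close>
definition sym_unit :: "'d \<Rightarrow> 'd \<Rightarrow> 'd \<Rightarrow> 'd \<Rightarrow> real" where
  "sym_unit i j p q = ((if p = i then if q = j then 1 else 0 else 0)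
                     + (if p = j then if q = i then 1 else 0 else 0)) / 2"

lemma P_field_has_weak_partial:
  fixes Y :: "(real ^ 'd::finite) set"
  assumes "open Y" "bounded Y"
  shows "has_weak_partial Y q (\<lambda>y. P_field i j y $ p) (\<lambda>y. sym_unit i j p q)"
proof -
  have half: "has_weak_partial Y q (\<lambda>y. c * y $ i) (\<lambda>y. c * (if q = i then 1 else 0))" for c i
  proof -
    have "smooth (\<lambda>y::real^'d. c * y $ i)"
      by (intro smooth_mult smooth_const smooth_coordinate)
    moreover have "((\<lambda>y::real^'d. c * y $ i) has_derivative (\<lambda>h. c * h $ i)) (at y)" for y
      by (intro has_derivative_mult_right bounded_linear_imp_has_derivative bounded_linear_vec_nth)
    then have "partial q (\<lambda>y::real^'d. c * y $ i) y = c * axis q 1 $ i" for y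
      by (rule partial_eqI)
    then have "partial q (\<lambda>y. c * y $ i) = (\<lambda>y::real^'d. c * (if q = i then 1 else 0))"
      by (auto simp: axis_def)
    ultimately show ?thesis
      using smooth_has_weak_partial[OF assms, of "\<lambda>y. c * y $ i" q] by simp
  qed
  have "(\<lambda>y. P_field i j y $ p) =
      (\<lambda>y. (if p = j then 1 / 2 else 0) * y $ i + (if p = i then 1 / 2 else 0) * y $ j)"
    by (auto simp: P_field_def axis_def fun_eq_iff)
  moreover have "(\<lambda>y::real^'d. sym_unit i j p q) =
      (\<lambda>y. (if p = j then 1 / 2 else 0) * (if q = i then 1 else 0)
         + (if p = i then 1 / 2 else 0) * (if q = j then 1 else 0))"
    by (auto simp: sym_unit_def fun_eq_iff)
  ultimately show ?thesis
    using has_weak_partial_add[OF assms half half] by (simp only:)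
qed

lemma wD_add_P_field:
  fixes Y :: "(real ^ 'd::finite) set"
  assumes "open Y" "bounded Y" "u \<in> H1 Y"
  shows "AE y in lebesgue_on Y. wD Y (\<lambda>y. u y + P_field i j y) p q y = wD Y u p q y + sym_unit i j p q"
  using has_weak_partial_add[OF assms(1,2) H1_has_weak_partial_wD[OF assms(3)]
      P_field_has_weak_partial[OF assms(1,2)]]
  by (intro wD_AE_eq assms(1,2)) simp

section \<open>Contraction of tensors\<close>

lemma sum_sym_unit:
  "(\<Sum>p\<in>UNIV. \<Sum>q\<in>UNIV. sym_unit i j p q * X p q) = (X i j + X j (i::'d::finite)) / 2"
proof -
  have "(\<Sum>p\<in>UNIV. \<Sum>q\<in>UNIV. sym_unit i j p q * X p q) =
     (\<Sum>p\<in>UNIV. \<Sum>q\<in>UNIV. (if p = i then if q = j then X p q / 2 else 0 else 0))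
   + (\<Sum>p\<in>UNIV. \<Sum>q\<in>UNIV. (if p = j then if q = i then X p q / 2 else 0 else 0))"
    unfolding sum.distrib[symmetric]
    by (intro sum.cong refl) (auto simp: sym_unit_def)
  moreover have "(\<Sum>p\<in>UNIV. \<Sum>q\<in>UNIV. (if p = a then if q = c then X p q / 2 else 0 else 0)) = X a c / 2" for a c :: 'd
  proof -
    have "(\<Sum>q\<in>UNIV. (if p = a then if q = c then X p q / 2 else 0 else 0)) =
        (if p = a then X a c / 2 else 0)" for p
      by auto
    then show ?thesis by simp
  qed
  ultimately show ?thesis by (simp only: add_divide_distrib)
qed

text \<open>
The minor symmetries let the tensor see a symmetrised matrix unit as the plain matrix unit. Hence
contracting with the one in the right factor adds $G_{pqk\ell}$ to the stress of $z$, and contracting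
the result with the one in the left factor picks out the component $ij$.
\<close>
lemma strain_energy_add_sym_unit:
  fixes G :: "'d::finite \<Rightarrow> 'd \<Rightarrow> 'd \<Rightarrow> 'd \<Rightarrow> real"
  assumes "\<And>i j k l. G i j k l = G j i k l" "\<And>i j k l. G i j k l = G i j l k"
  shows "(\<Sum>p\<in>UNIV. \<Sum>q\<in>UNIV. \<Sum>r\<in>UNIV. \<Sum>s\<in>UNIV.
            (a p q + sym_unit i j p q) * G p q r s * (z r s + sym_unit k l r s))
       = (\<Sum>p\<in>UNIV. \<Sum>q\<in>UNIV. a p q * ((\<Sum>r\<in>UNIV. \<Sum>s\<in>UNIV. G p q r s * z r s) + G p q k l))
         + ((\<Sum>r\<in>UNIV. \<Sum>s\<in>UNIV. G i j r s * z r s) + G i j k l)"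
proof -
  define H where "H p q = (\<Sum>r\<in>UNIV. \<Sum>s\<in>UNIV. G p q r s * z r s) + G p q k l" for p q
  have "(\<Sum>r\<in>UNIV. \<Sum>s\<in>UNIV. A * G p q r s * (z r s + sym_unit k l r s)) = A * H p q" for A p q
  proof -
    have "(\<Sum>r\<in>UNIV. \<Sum>s\<in>UNIV. sym_unit k l r s * G p q r s) = G p q k l"
      unfolding sum_sym_unit using assms(2)[of p q k l] by simp
    then have "H p q = (\<Sum>r\<in>UNIV. \<Sum>s\<in>UNIV. G p q r s * (z r s + sym_unit k l r s))"
      by (simp add: H_def distrib_left sum.distrib mult.commute)
    then show ?thesis by (simp add: sum_distrib_left mult.assoc)
  qed
  then have "(\<Sum>p\<in>UNIV. \<Sum>q\<in>UNIV. \<Sum>r\<in>UNIV. \<Sum>s\<in>UNIV.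
            (a p q + sym_unit i j p q) * G p q r s * (z r s + sym_unit k l r s))
      = (\<Sum>p\<in>UNIV. \<Sum>q\<in>UNIV. a p q * H p q) + (\<Sum>p\<in>UNIV. \<Sum>q\<in>UNIV. sym_unit i j p q * H p q)"
    by (simp add: distrib_right sum.distrib)
  moreover have "H j i = H i j"
    unfolding H_def using assms(1)[of j i] by simp
  ultimately show ?thesis
    unfolding sum_sym_unit by (simp add: H_def)
qed

lemma sum_pairs_swap:
  fixes F :: "'d::finite \<Rightarrow> 'd \<Rightarrow> 'd \<Rightarrow> 'd \<Rightarrow> real"
  shows "(\<Sum>i\<in>UNIV. \<Sum>j\<in>UNIV. \<Sum>k\<in>UNIV. \<Sum>l\<in>UNIV. F i j k l)
       = (\<Sum>k\<in>UNIV. \<Sum>l\<in>UNIV. \<Sum>i\<in>UNIV. \<Sum>j\<in>UNIV. F i j k l)"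
proof -
  have "(\<Sum>i\<in>UNIV. \<Sum>j\<in>UNIV. \<Sum>k\<in>UNIV. \<Sum>l\<in>UNIV. F i j k l)
      = (\<Sum>i\<in>UNIV. \<Sum>k\<in>UNIV. \<Sum>j\<in>UNIV. \<Sum>l\<in>UNIV. F i j k l)"
    by (rule sum.cong[OF refl sum.swap])
  also have "\<dots> = (\<Sum>k\<in>UNIV. \<Sum>i\<in>UNIV. \<Sum>j\<in>UNIV. \<Sum>l\<in>UNIV. F i j k l)"
    by (rule sum.swap)
  also have "\<dots> = (\<Sum>k\<in>UNIV. \<Sum>i\<in>UNIV. \<Sum>l\<in>UNIV. \<Sum>j\<in>UNIV. F i j k l)"
    by (rule sum.cong[OF refl sum.cong[OF refl sum.swap]])
  also have "\<dots> = (\<Sum>k\<in>UNIV. \<Sum>l\<in>UNIV. \<Sum>i\<in>UNIV. \<Sum>j\<in>UNIV. F i j k l)"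
    by (rule sum.cong[OF refl sum.swap])
  finally show ?thesis .
qed

section \<open>The energy form on an elastic cell\<close>

text \<open>
The stress $C_{ijpq} u_{p,q}$ of a displacement. The form $A$, all cell problems and all effective
tensors see the gradients of the cell functions mostly through it.
\<close>
definition stress ::
  "(real ^ 'd::finite) set \<Rightarrow> 'd tensor_field \<Rightarrow> (real ^ 'd \<Rightarrow> real ^ 'd) \<Rightarrow> 'd \<Rightarrow> 'd \<Rightarrow> real ^ 'd \<Rightarrow> real" where
  "stress Y C u i j y = (\<Sum>p\<in>UNIV. \<Sum>q\<in>UNIV. C i j p q y * wD Y u p q y)"

locale elastic_cell =
  fixes Y :: "(real ^ 'd::finite) set" and C :: "'d tensor_field"
  assumes open_Y: "open Y" and bounded_Y: "bounded Y" and elastic: "elasticity_tensor Y C"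
begin

lemma AE_symmetries:
  "AE y in lebesgue_on Y. \<forall>i j k l.
     C i j k l y = C j i k l y \<and> C i j k l y = C i j l k y \<and> C i j k l y = C k l i j y"
  using elastic unfolding elasticity_tensor_def AE_all_countable by blast

lemma C_mult_L2: "f \<in> L2 Y \<Longrightarrow> (\<lambda>y. C i j k l y * f y) \<in> L2 Y"
  using elastic unfolding elasticity_tensor_def by (blast intro: L2_bounded_mult)

lemma C_L2: "C i j k l \<in> L2 Y"
  using C_mult_L2[OF L2_const[OF open_Y bounded_Y, of 1]] by simp

lemma stress_L2: "u \<in> H1 Y \<Longrightarrow> stress Y C u i j \<in> L2 Y"
  unfolding stress_def[abs_def] by (intro L2_sum C_mult_L2 H1_wD_L2) auto

lemma S0_eq: "S0 Y C \<chi>1 k l i j y = stress Y C (\<chi>1 k l) i j y + C i j k l y"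
  by (simp add: S0_def stress_def)

lemma S0_L2: "\<chi>1 k l \<in> H1 Y \<Longrightarrow> S0 Y C \<chi>1 k l i j \<in> L2 Y"
  unfolding S0_eq[abs_def] by (intro L2_add stress_L2 C_L2)

lemma integrable_sum_mult:
  "(\<And>p. f p \<in> L2 Y) \<Longrightarrow> (\<And>p. g p \<in> L2 Y) \<Longrightarrow>
    integrable (lebesgue_on Y) (\<lambda>y. \<Sum>p\<in>(UNIV::'d set). f p y * g p y)"
  by (intro Bochner_Integration.integrable_sum L2_mult_integrable)

lemma bform_eq: "bform Y C w v = (LINT y|lebesgue_on Y. (\<Sum>i\<in>UNIV. \<Sum>j\<in>UNIV. wD Y w i j y * stress Y C v i j y))"
  by (simp add: bform_def stress_def sum_distrib_left mult.assoc)

lemma bform_integrand_integrable: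
  "w \<in> H1 Y \<Longrightarrow> v \<in> H1 Y \<Longrightarrow>
    integrable (lebesgue_on Y) (\<lambda>y. \<Sum>i\<in>UNIV. \<Sum>j\<in>UNIV. wD Y w i j y * stress Y C v i j y)"
  by (intro Bochner_Integration.integrable_sum L2_mult_integrable H1_wD_L2 stress_L2)

text \<open>
The major symmetry of $C$ holds for almost every point only, so the integrands agree almost
everywhere.
\<close>
lemma bform_sym:
  assumes "w \<in> H1 Y" "v \<in> H1 Y"
  shows "bform Y C w v = bform Y C v w"
proof -
  have meas: "(\<lambda>y. \<Sum>i\<in>UNIV. \<Sum>j\<in>UNIV. wD Y w i j y * stress Y C v i j y) \<in> borel_measurable (lebesgue_on Y)"
    if "w \<in> H1 Y" "v \<in> H1 Y" for w v
    using bform_integrand_integrable[OF that] by auto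
  show ?thesis
    unfolding bform_eq
  proof (rule integral_cong_AE[OF meas[OF assms] meas[OF assms(2,1)]])
    show "AE y in lebesgue_on Y. (\<Sum>i\<in>UNIV. \<Sum>j\<in>UNIV. wD Y w i j y * stress Y C v i j y)
        = (\<Sum>i\<in>UNIV. \<Sum>j\<in>UNIV. wD Y v i j y * stress Y C w i j y)"
      using AE_symmetries
    proof eventually_elim
      case (elim y)
      have "(\<Sum>i\<in>UNIV. \<Sum>j\<in>UNIV. wD Y w i j y * stress Y C v i j y)
          = (\<Sum>i\<in>UNIV. \<Sum>j\<in>UNIV. \<Sum>k\<in>UNIV. \<Sum>l\<in>UNIV. wD Y w i j y * (C i j k l y * wD Y v k l y))"
        by (simp add: stress_def sum_distrib_left)
      also have "\<dots> = (\<Sum>k\<in>UNIV. \<Sum>l\<in>UNIV. \<Sum>i\<in>UNIV. \<Sum>j\<in>UNIV. wD Y w i j y * (C i j k l y * wD Y v k l y))"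
        by (rule sum_pairs_swap)
      also have "\<dots> = (\<Sum>k\<in>UNIV. \<Sum>l\<in>UNIV. \<Sum>i\<in>UNIV. \<Sum>j\<in>UNIV. wD Y v k l y * (C k l i j y * wD Y w i j y))"
      proof (intro sum.cong refl)
        fix k l i j
        have "C i j k l y = C k l i j y" using elim by blast
        then show "wD Y w i j y * (C i j k l y * wD Y v k l y) = wD Y v k l y * (C k l i j y * wD Y w i j y)"
          by simp
      qed
      also have "\<dots> = (\<Sum>i\<in>UNIV. \<Sum>j\<in>UNIV. wD Y v i j y * stress Y C w i j y)"
        by (simp add: stress_def sum_distrib_left)
      finally show ?case .
    qed
  qed
qed

text \<open>
The mean contains the factor $1/|Y|$, which is $0$ by convention if $|Y| = 0$; in that case the
integral vanishes anyway.
\<close>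
lemma H1_sharp_integral_eq_0:
  assumes "v \<in> H1_sharp b Y"
  shows "(LINT y|lebesgue_on Y. v y $ p) = 0"
proof (cases "measure lebesgue Y = 0")
  case True
  then have "negligible Y"
    using open_Y bounded_Y by (simp add: negligible_iff_measure lmeasurable_open)
  then have "AE y in lebesgue. y \<notin> Y"
    by (simp add: negligible_iff_null_sets AE_not_in)
  then have "AE y in lebesgue_on Y. v y $ p = 0"
    using open_Y by (subst AE_restrict_space_iff) auto
  then show ?thesis by (rule integral_eq_zero_AE)
next
  case False
  then show ?thesis using assms by (simp add: H1_sharp_def cell_mean_def)
qed

section \<open>Reciprocity between cell functions\<close>

text \<open>
The load in the second and third cell problems, split into its two parts. The constants \<open>c r\<close>, which
balance the load, pair to zero with the mean-free field \<open>v\<close>. Here \<open>f\<close> is the cell stress and \<open>u\<close> the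
cell function of the preceding order.
\<close>
lemma cell_load_eq:
  assumes v: "v \<in> H1_sharp b Y" and f: "\<And>r. f r \<in> L2 Y" and u: "u \<in> H1 Y"
  shows "(LINT y|lebesgue_on Y. (\<Sum>r\<in>UNIV. (f r y - c r) * v y $ r)
            - (\<Sum>p\<in>UNIV. \<Sum>r\<in>UNIV. \<Sum>s\<in>UNIV. u y $ p * C p n r s y * wD Y v r s y))
       = (LINT y|lebesgue_on Y. (\<Sum>r\<in>UNIV. f r y * v y $ r))
         - (LINT y|lebesgue_on Y. (\<Sum>p\<in>UNIV. u y $ p * stress Y C v p n y))"
proof -
  note vH1 = H1_sharp_imp_H1[OF v]
  have v2: "(\<lambda>y. v y $ r) \<in> L2 Y" for r by (rule H1_component_L2[OF vH1])
  have "(LINT y|lebesgue_on Y. (\<Sum>r\<in>UNIV. (f r y - c r) * v y $ r)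
            - (\<Sum>p\<in>UNIV. \<Sum>r\<in>UNIV. \<Sum>s\<in>UNIV. u y $ p * C p n r s y * wD Y v r s y))
      = (LINT y|lebesgue_on Y. (\<Sum>r\<in>UNIV. f r y * v y $ r) - (\<Sum>r\<in>UNIV. c r * v y $ r)
            - (\<Sum>p\<in>UNIV. u y $ p * stress Y C v p n y))"
    by (simp add: stress_def sum_distrib_left mult.assoc left_diff_distrib sum_subtractf)
  also have "\<dots> = (LINT y|lebesgue_on Y. (\<Sum>r\<in>UNIV. f r y * v y $ r))
         - (LINT y|lebesgue_on Y. (\<Sum>r\<in>UNIV. c r * v y $ r))
         - (LINT y|lebesgue_on Y. (\<Sum>p\<in>UNIV. u y $ p * stress Y C v p n y))"
    by (subst Bochner_Integration.integral_diff; (subst Bochner_Integration.integral_diff)?)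
       (intro Bochner_Integration.integrable_diff integrable_sum_mult f v2 H1_component_L2[OF u]
          stress_L2[OF vH1] L2_const open_Y bounded_Y refl)+
  also have "(LINT y|lebesgue_on Y. (\<Sum>r\<in>UNIV. c r * v y $ r)) = 0"
    using L2_integrable[OF open_Y bounded_Y v2] H1_sharp_integral_eq_0[OF v]
    by (subst Bochner_Integration.integral_sum) auto
  finally show ?thesis by simp
qed

text \<open>
By the symmetries of $C$ the stress is a symmetric matrix, and the loading indices $ij$ can be
exchanged with the component indices $mp$ in the constant part of $S^{0,ij}_{mp}$.
\<close>
lemma S0_transpose:
  "AE y in lebesgue_on Y. \<forall>m p. S0 Y C \<chi>1 i j m p y = stress Y C (\<chi>1 i j) p m y + C i j p m y"
  using AE_symmetries
proof eventually_elim
  case (elim y)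
  have "stress Y C (\<chi>1 i j) m p y = stress Y C (\<chi>1 i j) p m y" for m p
    unfolding stress_def using elim by (intro sum.cong refl) metis
  moreover have "C m p i j y = C i j p m y" for m p using elim by metis
  ultimately show ?case by (simp add: S0_eq)
qed

text \<open>
The common core of the formulas for $C^1$ and $C^2$. The stress integral of the new cell function \<open>w\<close> is
eliminated in two steps. The problem for $\chi^{1ij}$, tested with \<open>w\<close>, turns it into
$-A(\chi^{1ij}, w)$; by symmetry of $A$ this is $-A(w, \chi^{1ij})$, which the problem for \<open>w\<close>, tested
with $\chi^{1ij}$, expresses by the data \<open>f\<close> and \<open>u\<close> of the preceding order. The terms in \<open>u\<close> combine
to $S^{0,ij}$.
\<close>
lemma integral_stress_reciprocity:
  assumes \<chi>1: "first_cell_functions b Y C \<chi>1"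
    and w: "w \<in> H1_sharp b Y" and f: "\<And>r. f r \<in> L2 Y" and u: "u \<in> H1 Y"
    and cell: "\<And>v. v \<in> H1_sharp b Y \<Longrightarrow> bform Y C w v =
       (LINT y|lebesgue_on Y. (\<Sum>r\<in>UNIV. (f r y - c r) * v y $ r)
            - (\<Sum>p\<in>UNIV. \<Sum>r\<in>UNIV. \<Sum>s\<in>UNIV. u y $ p * C p n r s y * wD Y v r s y))"
  shows "(LINT y|lebesgue_on Y. stress Y C w i j y + (\<Sum>p\<in>UNIV. C i j p n y * u y $ p))
       = (LINT y|lebesgue_on Y. (\<Sum>p\<in>UNIV. S0 Y C \<chi>1 i j n p y * u y $ p))
         - (LINT y|lebesgue_on Y. (\<Sum>r\<in>UNIV. f r y * \<chi>1 i j y $ r))"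
proof -
  have \<chi>: "\<chi>1 i j \<in> H1_sharp b Y" using \<chi>1 by (simp add: first_cell_functions_def)
  note \<chi>H1 = H1_sharp_imp_H1[OF \<chi>] and wH1 = H1_sharp_imp_H1[OF w]
  note u2 = H1_component_L2[OF u]
  note int_Cu = integrable_sum_mult[OF C_L2 u2] and int_stress = integrable_sum_mult[OF u2 stress_L2[OF \<chi>H1]]
  have "(LINT y|lebesgue_on Y. stress Y C w i j y + (\<Sum>p\<in>UNIV. C i j p n y * u y $ p))
      = (LINT y|lebesgue_on Y. stress Y C w i j y)
        + (LINT y|lebesgue_on Y. (\<Sum>p\<in>UNIV. C i j p n y * u y $ p))"
    by (rule Bochner_Integration.integral_add[OF L2_integrable[OF open_Y bounded_Y stress_L2[OF wH1]] int_Cu])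
  also have "(LINT y|lebesgue_on Y. stress Y C w i j y) = - bform Y C (\<chi>1 i j) w"
    using \<chi>1 w by (simp add: first_cell_functions_def stress_def)
  also have "bform Y C (\<chi>1 i j) w = bform Y C w (\<chi>1 i j)"
    by (rule bform_sym[OF \<chi>H1 wH1])
  also have "\<dots> = (LINT y|lebesgue_on Y. (\<Sum>r\<in>UNIV. f r y * \<chi>1 i j y $ r))
         - (LINT y|lebesgue_on Y. (\<Sum>p\<in>UNIV. u y $ p * stress Y C (\<chi>1 i j) p n y))"
    unfolding cell[OF \<chi>] by (rule cell_load_eq[OF \<chi> f u])
  finally have tested: "(LINT y|lebesgue_on Y. stress Y C w i j y + (\<Sum>p\<in>UNIV. C i j p n y * u y $ p))
      = - ((LINT y|lebesgue_on Y. (\<Sum>r\<in>UNIV. f r y * \<chi>1 i j y $ r))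
         - (LINT y|lebesgue_on Y. (\<Sum>p\<in>UNIV. u y $ p * stress Y C (\<chi>1 i j) p n y)))
        + (LINT y|lebesgue_on Y. (\<Sum>p\<in>UNIV. C i j p n y * u y $ p))" .
  have "(LINT y|lebesgue_on Y. (\<Sum>p\<in>UNIV. S0 Y C \<chi>1 i j n p y * u y $ p))
      = (LINT y|lebesgue_on Y. (\<Sum>p\<in>UNIV. u y $ p * stress Y C (\<chi>1 i j) p n y)
          + (\<Sum>p\<in>UNIV. C i j p n y * u y $ p))"
  proof (rule integral_cong_AE)
    show "AE y in lebesgue_on Y. (\<Sum>p\<in>UNIV. S0 Y C \<chi>1 i j n p y * u y $ p)
       = (\<Sum>p\<in>UNIV. u y $ p * stress Y C (\<chi>1 i j) p n y) + (\<Sum>p\<in>UNIV. C i j p n y * u y $ p)"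
      using S0_transpose[of \<chi>1 i j]
      by eventually_elim (simp add: sum.distrib distrib_left mult.commute)
  qed (rule borel_measurable_integrable Bochner_Integration.integrable_add[OF int_stress int_Cu]
      integrable_sum_mult[OF S0_L2[of \<chi>1, OF \<chi>H1] u2])+
  also have "\<dots> = (LINT y|lebesgue_on Y. (\<Sum>p\<in>UNIV. u y $ p * stress Y C (\<chi>1 i j) p n y))
          + (LINT y|lebesgue_on Y. (\<Sum>p\<in>UNIV. C i j p n y * u y $ p))"
    by (rule Bochner_Integration.integral_add[OF int_stress int_Cu])
  finally show ?thesis using tested by simp
qed

section \<open>The effective tensors\<close>

text \<open>
The first cell problem in divergence form: the cell stress is in equilibrium, so it does no work
on periodic displacements.
\<close>
lemma S0_orthogonal:
  assumes \<chi>1: "first_cell_functions b Y C \<chi>1" and v: "v \<in> H1_sharp b Y"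
  shows "(LINT y|lebesgue_on Y. (\<Sum>p\<in>UNIV. \<Sum>q\<in>UNIV. wD Y v p q y * S0 Y C \<chi>1 k l p q y)) = 0"
proof -
  have \<chi>H1: "\<chi>1 k l \<in> H1 Y" and vH1: "v \<in> H1 Y"
    using \<chi>1 v H1_sharp_imp_H1 unfolding first_cell_functions_def by blast+
  have int: "integrable (lebesgue_on Y) (\<lambda>y. \<Sum>p\<in>UNIV. \<Sum>q\<in>UNIV. wD Y v p q y * C p q k l y)"
    by (intro Bochner_Integration.integrable_sum L2_mult_integrable H1_wD_L2[OF vH1] C_L2)
  have "(LINT y|lebesgue_on Y. (\<Sum>p\<in>UNIV. \<Sum>q\<in>UNIV. wD Y v p q y * S0 Y C \<chi>1 k l p q y))
      = (LINT y|lebesgue_on Y. (\<Sum>p\<in>UNIV. \<Sum>q\<in>UNIV. wD Y v p q y * stress Y C (\<chi>1 k l) p q y)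
            + (\<Sum>p\<in>UNIV. \<Sum>q\<in>UNIV. wD Y v p q y * C p q k l y))"
    by (simp add: S0_eq distrib_left sum.distrib)
  also have "\<dots> = bform Y C v (\<chi>1 k l)
      + (LINT y|lebesgue_on Y. (\<Sum>p\<in>UNIV. \<Sum>q\<in>UNIV. wD Y v p q y * C p q k l y))"
    unfolding bform_eq
    by (rule Bochner_Integration.integral_add[OF bform_integrand_integrable[OF vH1 \<chi>H1] int])
  also have "bform Y C v (\<chi>1 k l) = bform Y C (\<chi>1 k l) v"
    by (rule bform_sym[OF vH1 \<chi>H1])
  also have "\<dots> = - (LINT y|lebesgue_on Y. (\<Sum>p\<in>UNIV. \<Sum>q\<in>UNIV. C k l p q y * wD Y v p q y))"
    using \<chi>1 v by (simp add: first_cell_functions_def)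
  also have "(LINT y|lebesgue_on Y. (\<Sum>p\<in>UNIV. \<Sum>q\<in>UNIV. C k l p q y * wD Y v p q y))
           = (LINT y|lebesgue_on Y. (\<Sum>p\<in>UNIV. \<Sum>q\<in>UNIV. wD Y v p q y * C p q k l y))"
  proof (rule integral_cong_AE)
    show "AE y in lebesgue_on Y. (\<Sum>p\<in>UNIV. \<Sum>q\<in>UNIV. C k l p q y * wD Y v p q y)
        = (\<Sum>p\<in>UNIV. \<Sum>q\<in>UNIV. wD Y v p q y * C p q k l y)"
      using AE_symmetries
    proof eventually_elim
      case (elim y)
      have "C k l p q y = C p q k l y" for p q using elim by blast
      then show ?case by (simp add: mult.commute)
    qed
    show "(\<lambda>y. \<Sum>p\<in>UNIV. \<Sum>q\<in>UNIV. C k l p q y * wD Y v p q y) \<in> borel_measurable (lebesgue_on Y)"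
      by (intro borel_measurable_integrable Bochner_Integration.integrable_sum L2_mult_integrable
          H1_wD_L2[OF vH1] C_L2)
  qed (rule borel_measurable_integrable[OF int])
  finally show ?thesis by simp
qed

text \<open>
Expanding the energy gives the work of $S^{0,k\ell}$ on $\chi^{1ij}$, which vanishes, and its work on
the constant strain of $P^{ij}$, which is the integral of its component $ij$.
\<close>
lemma bform_add_P_field:
  assumes \<chi>1: "first_cell_functions b Y C \<chi>1"
  shows "bform Y C (\<lambda>y. \<chi>1 i j y + P_field i j y) (\<lambda>y. \<chi>1 k l y + P_field k l y)
       = (LINT y|lebesgue_on Y. S0 Y C \<chi>1 k l i j y)"
proof -
  have \<chi>: "\<chi>1 i j \<in> H1_sharp b Y" for i j using \<chi>1 by (simp add: first_cell_functions_def)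
  note \<chi>H1 = H1_sharp_imp_H1[OF \<chi>]
  let ?w = "\<lambda>y. \<chi>1 i j y + P_field i j y" and ?v = "\<lambda>y. \<chi>1 k l y + P_field k l y"
  have AE_wD: "AE y in lebesgue_on Y. \<forall>p q. wD Y (\<lambda>y. \<chi>1 i j y + P_field i j y) p q y
      = wD Y (\<chi>1 i j) p q y + sym_unit i j p q" for i j
    unfolding AE_all_countable using wD_add_P_field[OF open_Y bounded_Y \<chi>H1] by blast
  have H1_add: "(\<lambda>y. \<chi>1 i j y + P_field i j y) \<in> H1 Y" for i j
    using has_weak_partial_add[OF open_Y bounded_Y H1_has_weak_partial_wD[OF \<chi>H1]
      P_field_has_weak_partial[OF open_Y bounded_Y]] unfolding H1_def by fastforce
  have int: "integrable (lebesgue_on Y) (\<lambda>y. \<Sum>p\<in>UNIV. \<Sum>q\<in>UNIV. wD Y (\<chi>1 i j) p q y * S0 Y C \<chi>1 k l p q y)"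
    by (intro Bochner_Integration.integrable_sum L2_mult_integrable H1_wD_L2[OF \<chi>H1] S0_L2[of \<chi>1, OF \<chi>H1])
  have int_S0: "integrable (lebesgue_on Y) (S0 Y C \<chi>1 k l i j)"
    by (rule L2_integrable[OF open_Y bounded_Y S0_L2[of \<chi>1, OF \<chi>H1]])
  have "bform Y C ?w ?v = (LINT y|lebesgue_on Y.
      (\<Sum>p\<in>UNIV. \<Sum>q\<in>UNIV. wD Y (\<chi>1 i j) p q y * S0 Y C \<chi>1 k l p q y) + S0 Y C \<chi>1 k l i j y)"
    unfolding bform_eq
  proof (rule integral_cong_AE)
    show "AE y in lebesgue_on Y. (\<Sum>p\<in>UNIV. \<Sum>q\<in>UNIV. wD Y ?w p q y * stress Y C ?v p q y)
      = (\<Sum>p\<in>UNIV. \<Sum>q\<in>UNIV. wD Y (\<chi>1 i j) p q y * S0 Y C \<chi>1 k l p q y) + S0 Y C \<chi>1 k l i j y"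
      using AE_wD[of i j] AE_wD[of k l] AE_symmetries
    proof eventually_elim
      case (elim y)
      have "C i j k l y = C j i k l y" "C i j k l y = C i j l k y" for i j k l
        using elim(3) by blast+
      note expand = strain_energy_add_sym_unit[of "\<lambda>p q r s. C p q r s y", OF this]
      show ?case
        using expand[of "\<lambda>p q. wD Y (\<chi>1 i j) p q y" i j "\<lambda>p q. wD Y (\<chi>1 k l) p q y" k l] elim(1,2)
        by (simp add: stress_def S0_def sum_distrib_left mult.assoc)
    qed
  qed (rule borel_measurable_integrable bform_integrand_integrable H1_add
      Bochner_Integration.integrable_add[OF int int_S0])+
  also have "\<dots> = (LINT y|lebesgue_on Y. (\<Sum>p\<in>UNIV. \<Sum>q\<in>UNIV. wD Y (\<chi>1 i j) p q y * S0 Y C \<chi>1 k l p q y))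
      + (LINT y|lebesgue_on Y. S0 Y C \<chi>1 k l i j y)"
    by (rule Bochner_Integration.integral_add[OF int int_S0])
  finally show ?thesis
    using S0_orthogonal[OF \<chi>1 \<chi>] by simp
qed

text \<open>
Reciprocity for $w = \chi^{2k\ell m}$, where $f = S^{0,k\ell}_{m\cdot}$ and $u = \chi^{1k\ell}$.
\<close>
lemma integral_S1:
  assumes \<chi>1: "first_cell_functions b Y C \<chi>1" and \<chi>2: "second_cell_functions b Y C \<chi>1 \<chi>2"
  shows "(LINT y|lebesgue_on Y. S1 Y C \<chi>1 \<chi>2 k l m i j y)
       = (LINT y|lebesgue_on Y. (\<Sum>p\<in>UNIV.
            S0 Y C \<chi>1 i j m p y * \<chi>1 k l y $ p - S0 Y C \<chi>1 k l m p y * \<chi>1 i j y $ p))"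
proof -
  have \<chi>H1: "\<chi>1 i j \<in> H1 Y" for i j
    using \<chi>1 H1_sharp_imp_H1 unfolding first_cell_functions_def by blast
  have \<chi>2_sharp: "\<chi>2 k l m \<in> H1_sharp b Y"
    using \<chi>2 by (simp add: second_cell_functions_def)
  note S0_2 = S0_L2[of \<chi>1, OF \<chi>H1] and \<chi>_2 = H1_component_L2[OF \<chi>H1]
  have "(LINT y|lebesgue_on Y. S1 Y C \<chi>1 \<chi>2 k l m i j y)
      = (LINT y|lebesgue_on Y. stress Y C (\<chi>2 k l m) i j y + (\<Sum>p\<in>UNIV. C i j p m y * \<chi>1 k l y $ p))"
    by (simp add: S1_def stress_def)
  also have "\<dots> = (LINT y|lebesgue_on Y. (\<Sum>p\<in>UNIV. S0 Y C \<chi>1 i j m p y * \<chi>1 k l y $ p))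
         - (LINT y|lebesgue_on Y. (\<Sum>r\<in>UNIV. S0 Y C \<chi>1 k l m r y * \<chi>1 i j y $ r))"
    by (rule integral_stress_reciprocity[OF \<chi>1 \<chi>2_sharp S0_2 \<chi>H1, where c = "\<lambda>r. C0 Y C \<chi>1 k l m r"])
       (use \<chi>2 in \<open>simp add: second_cell_functions_def\<close>)
  also have "\<dots> = (LINT y|lebesgue_on Y. (\<Sum>p\<in>UNIV. S0 Y C \<chi>1 i j m p y * \<chi>1 k l y $ p)
         - (\<Sum>p\<in>UNIV. S0 Y C \<chi>1 k l m p y * \<chi>1 i j y $ p))"
    by (rule Bochner_Integration.integral_diff[OF integrable_sum_mult[OF S0_2 \<chi>_2]
          integrable_sum_mult[OF S0_2 \<chi>_2], symmetric])
  finally show ?thesis by (simp add: sum_subtractf)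
qed

text \<open>
Reciprocity for $w = \chi^{3k\ell mn}$ leaves a term with $S^{0,ij}$ and $\chi^{2k\ell m}$ and a term with
$S^{1,k\ell m}$ and $\chi^{1ij}$. The former occurs in the problem for $\chi^{2ijn}$ tested with
$\chi^{2k\ell m}$. After substitution the parts with the gradient of $\chi^{2k\ell m}$ cancel, and
what is left of $S^{1,k\ell m}$ is its term in $\chi^{1k\ell}$ itself.
\<close>
lemma integral_second_order_stress:
  assumes \<chi>1: "first_cell_functions b Y C \<chi>1" and \<chi>2: "second_cell_functions b Y C \<chi>1 \<chi>2"
    and \<chi>3: "third_cell_functions b Y C \<chi>1 \<chi>2 \<chi>3"
  shows "(LINT y|lebesgue_on Y. (\<Sum>p\<in>UNIV. \<Sum>q\<in>UNIV.
             C i j p q y * (wD Y (\<chi>3 k l m n) p q y + \<chi>2 k l m y $ p * (if q = n then 1 else 0))))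
       = bform Y C (\<chi>2 i j n) (\<chi>2 k l m)
         - (LINT y|lebesgue_on Y. (\<Sum>p\<in>UNIV. \<Sum>a\<in>UNIV. \<chi>1 i j y $ p * C p n a m y * \<chi>1 k l y $ a))"
proof -
  have \<chi>H1: "\<chi>1 i j \<in> H1 Y" for i j
    using \<chi>1 H1_sharp_imp_H1 unfolding first_cell_functions_def by blast
  have \<chi>2_sharp: "\<chi>2 k l m \<in> H1_sharp b Y" for k l m
    using \<chi>2 by (simp add: second_cell_functions_def)
  have \<chi>3_sharp: "\<chi>3 k l m n \<in> H1_sharp b Y"
    using \<chi>3 by (simp add: third_cell_functions_def)
  note \<chi>2H1 = H1_sharp_imp_H1[OF \<chi>2_sharp]
  note S0_2 = S0_L2[of \<chi>1, OF \<chi>H1] and \<chi>_2 = H1_component_L2[OF \<chi>H1]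
  have C_\<chi>_2: "(\<lambda>y. \<Sum>a\<in>UNIV. C p n a m y * \<chi>1 k l y $ a) \<in> L2 Y" for p
    by (intro L2_sum C_mult_L2 \<chi>_2) simp
  have S1_eq: "S1 Y C \<chi>1 \<chi>2 k l m p n y
      = stress Y C (\<chi>2 k l m) p n y + (\<Sum>a\<in>UNIV. C p n a m y * \<chi>1 k l y $ a)" for p y
    by (simp add: S1_def stress_def)
  have S1_2: "S1 Y C \<chi>1 \<chi>2 k l m p n \<in> L2 Y" for p
    unfolding S1_eq[abs_def] by (intro L2_add stress_L2 \<chi>2H1 C_\<chi>_2)
  have "(\<Sum>q\<in>UNIV. C i j p q y * (\<chi>2 k l m y $ p * (if q = n then 1 else 0))) = C i j p n y * \<chi>2 k l m y $ p" for p y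
    by (subst sum.mono_neutral_right[where S = "{n}"]) auto
  then have "(LINT y|lebesgue_on Y. (\<Sum>p\<in>UNIV. \<Sum>q\<in>UNIV.
             C i j p q y * (wD Y (\<chi>3 k l m n) p q y + \<chi>2 k l m y $ p * (if q = n then 1 else 0))))
      = (LINT y|lebesgue_on Y. stress Y C (\<chi>3 k l m n) i j y + (\<Sum>p\<in>UNIV. C i j p n y * \<chi>2 k l m y $ p))"
    by (simp only: distrib_left sum.distrib stress_def)
  also have "\<dots> = (LINT y|lebesgue_on Y. (\<Sum>p\<in>UNIV. S0 Y C \<chi>1 i j n p y * \<chi>2 k l m y $ p))
         - (LINT y|lebesgue_on Y. (\<Sum>r\<in>UNIV. S1 Y C \<chi>1 \<chi>2 k l m r n y * \<chi>1 i j y $ r))"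
    by (rule integral_stress_reciprocity[OF \<chi>1 \<chi>3_sharp S1_2 \<chi>2H1, where c = "\<lambda>r. C1 Y C \<chi>1 \<chi>2 r n k l m"])
       (use \<chi>3 in \<open>simp add: third_cell_functions_def\<close>)
  also have "(LINT y|lebesgue_on Y. (\<Sum>r\<in>UNIV. S1 Y C \<chi>1 \<chi>2 k l m r n y * \<chi>1 i j y $ r))
      = (LINT y|lebesgue_on Y. (\<Sum>p\<in>UNIV. \<chi>1 i j y $ p * stress Y C (\<chi>2 k l m) p n y)
          + (\<Sum>p\<in>UNIV. \<chi>1 i j y $ p * (\<Sum>a\<in>UNIV. C p n a m y * \<chi>1 k l y $ a)))"
    by (simp add: S1_eq sum.distrib distrib_left mult.commute)
  also have "\<dots> = (LINT y|lebesgue_on Y. (\<Sum>p\<in>UNIV. \<chi>1 i j y $ p * stress Y C (\<chi>2 k l m) p n y))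
          + (LINT y|lebesgue_on Y. (\<Sum>p\<in>UNIV. \<chi>1 i j y $ p * (\<Sum>a\<in>UNIV. C p n a m y * \<chi>1 k l y $ a)))"
    by (rule Bochner_Integration.integral_add[OF integrable_sum_mult[OF \<chi>_2 stress_L2[OF \<chi>2H1]]
          integrable_sum_mult[OF \<chi>_2 C_\<chi>_2]])
  also have "(\<lambda>y. \<Sum>p\<in>UNIV. \<chi>1 i j y $ p * (\<Sum>a\<in>UNIV. C p n a m y * \<chi>1 k l y $ a))
      = (\<lambda>y. \<Sum>p\<in>UNIV. \<Sum>a\<in>UNIV. \<chi>1 i j y $ p * C p n a m y * \<chi>1 k l y $ a)"
    by (simp add: sum_distrib_left mult.assoc)
  finally have reciprocity: "(LINT y|lebesgue_on Y. (\<Sum>p\<in>UNIV. \<Sum>q\<in>UNIV.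
             C i j p q y * (wD Y (\<chi>3 k l m n) p q y + \<chi>2 k l m y $ p * (if q = n then 1 else 0))))
      = (LINT y|lebesgue_on Y. (\<Sum>p\<in>UNIV. S0 Y C \<chi>1 i j n p y * \<chi>2 k l m y $ p))
        - ((LINT y|lebesgue_on Y. (\<Sum>p\<in>UNIV. \<chi>1 i j y $ p * stress Y C (\<chi>2 k l m) p n y))
          + (LINT y|lebesgue_on Y. (\<Sum>p\<in>UNIV. \<Sum>a\<in>UNIV. \<chi>1 i j y $ p * C p n a m y * \<chi>1 k l y $ a)))" .
  have "bform Y C (\<chi>2 i j n) (\<chi>2 k l m)
      = (LINT y|lebesgue_on Y. (\<Sum>r\<in>UNIV. (S0 Y C \<chi>1 i j n r y - C0 Y C \<chi>1 i j n r) * \<chi>2 k l m y $ r)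
          - (\<Sum>p\<in>UNIV. \<Sum>r\<in>UNIV. \<Sum>s\<in>UNIV. \<chi>1 i j y $ p * C p n r s y * wD Y (\<chi>2 k l m) r s y))"
    using \<chi>2 \<chi>2_sharp by (simp add: second_cell_functions_def)
  also have "\<dots> = (LINT y|lebesgue_on Y. (\<Sum>r\<in>UNIV. S0 Y C \<chi>1 i j n r y * \<chi>2 k l m y $ r))
         - (LINT y|lebesgue_on Y. (\<Sum>p\<in>UNIV. \<chi>1 i j y $ p * stress Y C (\<chi>2 k l m) p n y))"
    by (rule cell_load_eq[OF \<chi>2_sharp S0_2 \<chi>H1])
  finally show ?thesis using reciprocity by simp
qed

end

theorem proposition1:
  fixes b :: "'d::finite \<Rightarrow> real ^ 'd"
    and Y :: "(real ^ 'd) set"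
    and C :: "'d \<Rightarrow> 'd \<Rightarrow> 'd \<Rightarrow> 'd \<Rightarrow> real ^ 'd \<Rightarrow> real"
    and \<chi>1 :: "'d \<Rightarrow> 'd \<Rightarrow> real ^ 'd \<Rightarrow> real ^ 'd"
    and \<chi>2 :: "'d \<Rightarrow> 'd \<Rightarrow> 'd \<Rightarrow> real ^ 'd \<Rightarrow> real ^ 'd"
    and \<chi>3 :: "'d \<Rightarrow> 'd \<Rightarrow> 'd \<Rightarrow> 'd \<Rightarrow> real ^ 'd \<Rightarrow> real ^ 'd"
  assumes "CARD('d) \<in> {2, 3}"
    and "periodicity_cell b Y"
    and "elasticity_tensor Y C"
    and "first_cell_functions b Y C \<chi>1"
    and "second_cell_functions b Y C \<chi>1 \<chi>2"
    and "third_cell_functions b Y C \<chi>1 \<chi>2 \<chi>3"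
  shows
    "(\<forall>i j k l.
        C0 Y C \<chi>1 i j k l =
          (1 / measure lebesgue Y) *
          bform Y C (\<lambda>y. \<chi>1 i j y + P_field i j y) (\<lambda>y. \<chi>1 k l y + P_field k l y)) \<and>
     (\<forall>i j k l m.
        C1 Y C \<chi>1 \<chi>2 i j k l m =
          (1 / measure lebesgue Y) *
          (LINT y|lebesgue_on Y. (\<Sum>p\<in>UNIV.
             S0 Y C \<chi>1 i j m p y * \<chi>1 k l y $ p - S0 Y C \<chi>1 k l m p y * \<chi>1 i j y $ p))) \<and>
     (\<forall>i j n k l m.
        C2 Y C \<chi>2 \<chi>3 i j n k l m =
          (1 / measure lebesgue Y) *
          (LINT y|lebesgue_on Y. (\<Sum>p\<in>UNIV. \<Sum>q\<in>UNIV. \<Sum>a\<in>UNIV. \<Sum>c\<in>UNIV.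
             wD Y (\<chi>2 i j n) p q y * C p q a c y * wD Y (\<chi>2 k l m) a c y))
          - (1 / measure lebesgue Y) *
          (LINT y|lebesgue_on Y. (\<Sum>p\<in>UNIV. \<Sum>a\<in>UNIV.
             \<chi>1 i j y $ p * C p n a m y * \<chi>1 k l y $ a)))"
proof -
  interpret elastic_cell Y C
    using assms(2,3) by unfold_locales (simp_all add: periodicity_cell_def)
  show ?thesis
    using bform_add_P_field[OF assms(4)] integral_S1[OF assms(4,5)]
      integral_second_order_stress[OF assms(4,5,6)]
    by (simp add: C0_def C1_def C2_def cell_mean_def bform_def right_diff_distrib)
qed

end
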